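(* Let $\kappa,\lambda$ be infinite cardinals with $\kappa\le\lambda\le 2^\kappa$. Then there exist $2^\lambda$ mutually non-homeomorphic scattered, strongly zero-dimensional, hereditarily paracompact, perfectly normal spaces $X$ with $|X|=\kappa$ and $w(X)=\lambda$. If $\lambda\le 2^\mu<2^\lambda$ for some infinite cardinal $\mu$, then it can be accomplished that all these $2^\lambda$ spaces are also almost discrete. Moreover, if $\lambda=2^\mu$ for some infinite cardinal $\mu$ (which includes the case $\lambda=2^\kappa$), then it can be accomplished that all these $2^\lambda$ spaces are almost discrete and extremally disconnected.
   Context: $|X|$ is the cardinality and $w(X)$ the weight (least size of a basis) of a topological space $X$. Normal and paracompact spaces are understood to be Hausdorff. A space is scattered if every nonempty subset $A$ contains a point isolated in the subspace $A$. A Hausdorff space $X$ is almost discrete if $X\setminus\{x\}$ is a discrete subspace of $X$ for some $x\in X$. A space is perfectly normal if it is normal and every closed set is a $G_\delta$-set. A normal space is strongly zero-dimensional if for every closed set $A$ and every open set $U\supset A$ there is an open-closed set $V$ with $A\subset V\subset U$. A space is hereditarily paracompact if every subspace is paracompact. A space is extremally disconnected if the closure of every open set is open. *)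

theory Defs
  imports "HOL-Analysis.Analysis"
begin

unbundle cardinal_syntax

definition topology_base :: "'a topology \<Rightarrow> 'a set set \<Rightarrow> bool" where
  "topology_base X \<B> \<longleftrightarrow> openin X = arbitrary union_of (\<lambda>U. U \<in> \<B>)"

(* The weight is a cardinal, hence determined only up to =o; "w(X) = \<Lambda>" is rendered as a relation
   saying that \<Lambda> is the least cardinality of a base. *)
definition has_weight :: "'a topology \<Rightarrow> 'b rel \<Rightarrow> bool" where
  "has_weight X \<Lambda> \<longleftrightarrow>
     (\<exists>\<B>. topology_base X \<B> \<and> |\<B>| =o \<Lambda>) \<and> (\<forall>\<B>. topology_base X \<B> \<longrightarrow> \<Lambda> \<le>o |\<B>| )"

definition scattered_space :: "'a topology \<Rightarrow> bool" where
  "scattered_space X \<longleftrightarrow>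
     (\<forall>A. A \<subseteq> topspace X \<and> A \<noteq> {} \<longrightarrow> (\<exists>x\<in>A. openin (subtopology X A) {x}))"

definition almost_discrete_space :: "'a topology \<Rightarrow> bool" where
  "almost_discrete_space X \<longleftrightarrow>
     Hausdorff_space X \<and>
     (\<exists>x\<in>topspace X. subtopology X (topspace X - {x}) = discrete_topology (topspace X - {x}))"

(* The library's normal_space does not include the Hausdorff axiom, so it is added here and in
   strongly_zero_dimensional_space. *)
definition perfectly_normal_space :: "'a topology \<Rightarrow> bool" where
  "perfectly_normal_space X \<longleftrightarrow>
     Hausdorff_space X \<and> normal_space X \<and> (\<forall>A. closedin X A \<longrightarrow> gdelta_in X A)"

definition strongly_zero_dimensional_space :: "'a topology \<Rightarrow> bool" where
  "strongly_zero_dimensional_space X \<longleftrightarrow>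
     Hausdorff_space X \<and> normal_space X \<and>
     (\<forall>A U. closedin X A \<and> openin X U \<and> A \<subseteq> U \<longrightarrow>
        (\<exists>V. openin X V \<and> closedin X V \<and> A \<subseteq> V \<and> V \<subseteq> U))"

definition paracompact_space :: "'a topology \<Rightarrow> bool" where
  "paracompact_space X \<longleftrightarrow>
     Hausdorff_space X \<and>
     (\<forall>\<U>. (\<forall>U\<in>\<U>. openin X U) \<and> \<Union>\<U> = topspace X \<longrightarrow>
        (\<exists>\<V>. (\<forall>V\<in>\<V>. openin X V) \<and> \<Union>\<V> = topspace X \<and>
             (\<forall>V\<in>\<V>. \<exists>U\<in>\<U>. V \<subseteq> U) \<and> locally_finite_in X \<V>))"

definition hereditarily_paracompact_space :: "'a topology \<Rightarrow> bool" where
  "hereditarily_paracompact_space X \<longleftrightarrow>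
     (\<forall>S. S \<subseteq> topspace X \<longrightarrow> paracompact_space (subtopology X S))"

definition extremally_disconnected_space :: "'a topology \<Rightarrow> bool" where
  "extremally_disconnected_space X \<longleftrightarrow> (\<forall>U. openin X U \<longrightarrow> openin X (X closure_of U))"

end

theory Submission
  imports Defs
begin

text \<open>Write \<open>I\<close> for the field of \<open>\<Lambda>\<close>. If \<open>\<Lambda> \<le> 2\<^sup>\<mu>\<close>, a set \<open>M\<close> of size \<open>\<mu>\<close> carries an independent
  family \<open>(A\<^sub>i)\<close> indexed by \<open>I\<close>. For \<open>S \<subseteq> I\<close> let \<open>A\<^sub>i\<^sup>S\<close> be \<open>A\<^sub>i\<close> or its complement, according to whether
  \<open>i \<in> S\<close>. A filter on \<open>M\<close> that contains all \<open>A\<^sub>i\<^sup>S\<close>, has a countable subfamily with empty intersection,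
  and whose members are contained in only finitely many \<open>A\<^sub>i\<^sup>S\<close>, yields an almost discrete space of
  weight \<open>\<Lambda>\<close>, and \<open>S\<close> can be read off from the filter. Such a filter is generated by the \<open>A\<^sub>i\<^sup>S\<close> and the complement of one
  countable intersection of them; adding the complements of all infinite intersections, it can be
  extended to an ultrafilter, which makes the space extremally disconnected. A homeomorphism class
  contains at most \<open>2\<^sup>\<mu>\<close> of these spaces, so \<open>2\<^sup>\<mu> < 2\<^sup>\<Lambda>\<close> leaves \<open>2\<^sup>\<Lambda>\<close> classes.

  For the first claim take \<open>\<mu> = \<kappa>\<close>. This fails only if \<open>2\<^sup>\<kappa> = 2\<^sup>\<Lambda>\<close>; then one such space is added to a
  metrizable scattered space of well-founded trees in which, for each \<open>i\<close> in a prescribed \<open>S \<subseteq> \<kappa>\<close>, some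
  point is the limit of a sequence of points of Cantor-Bendixson rank exactly \<open>i\<close> with no other
  accumulation points. The set \<open>S\<close> is a topological invariant.\<close>

section \<open>Tree-like neighbourhood systems\<close>

text \<open>\<open>N x\<close> serves as a neighbourhood base at \<open>x\<close>. That the
  predicate is a topology depends on the directedness \<open>N_dir\<close>, so it is only proved
  inside the locale, in \<open>openin_iff\<close>.\<close>

definition nbhd_topology :: "'p set \<Rightarrow> ('p \<Rightarrow> 'p set set) \<Rightarrow> 'p topology" where
  "nbhd_topology P N = topology (\<lambda>U. U \<subseteq> P \<and> (\<forall>x\<in>U. \<exists>V\<in>N x. V \<subseteq> U))"

text \<open>Common abstraction of the filter spaces (depth 0 at the limit point, 1 elsewhere) and
  the well-founded trees (depth is length). \<open>N_below\<close> makes the basic sets open. By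
  \<open>N_meet\<close>, basic sets meet only if one contains the centre of the other, which drives
  normality, zero-dimensionality and paracompactness; \<open>N_seq\<close> serves perfect normality
  and \<open>N_scat\<close> scatteredness.\<close>

locale nbhd_tree =
  fixes P :: "'p set" and N :: "'p \<Rightarrow> 'p set set" and d :: "'p \<Rightarrow> nat"
  assumes N_mem: "x \<in> P \<Longrightarrow> V \<in> N x \<Longrightarrow> x \<in> V \<and> V \<subseteq> P"
    and N_dir: "x \<in> P \<Longrightarrow> V \<in> N x \<Longrightarrow> V' \<in> N x \<Longrightarrow> \<exists>W\<in>N x. W \<subseteq> V \<inter> V'"
    and N_below: "x \<in> P \<Longrightarrow> V \<in> N x \<Longrightarrow> y \<in> V \<Longrightarrow> y \<noteq> x \<Longrightarrow> V' \<in> N y \<Longrightarrow> V' \<subseteq> V"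
    and N_depth: "x \<in> P \<Longrightarrow> V \<in> N x \<Longrightarrow> y \<in> V \<Longrightarrow> y \<noteq> x \<Longrightarrow> d x < d y"
    and N_meet: "x \<in> P \<Longrightarrow> y \<in> P \<Longrightarrow> V \<in> N x \<Longrightarrow> V' \<in> N y \<Longrightarrow> V \<inter> V' \<noteq> {} \<Longrightarrow> y \<in> V \<or> x \<in> V'"
    and N_seq: "x \<in> P \<Longrightarrow> \<exists>W::nat \<Rightarrow> 'p set. (\<forall>n. W n \<in> N x) \<and> decseq W \<and> (\<Inter>n. W n) = {x}"
    and N_scat: "A \<subseteq> P \<Longrightarrow> A \<noteq> {} \<Longrightarrow> \<exists>x\<in>A. \<exists>V\<in>N x. V \<inter> A = {x}"
begin

abbreviation X where "X \<equiv> nbhd_topology P N"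

lemma N_nonempty: "x \<in> P \<Longrightarrow> \<exists>V. V \<in> N x"
  using N_seq by blast

lemma openin_iff: "openin X U \<longleftrightarrow> U \<subseteq> P \<and> (\<forall>x\<in>U. \<exists>V\<in>N x. V \<subseteq> U)"
proof -
  have "istopology (\<lambda>U. U \<subseteq> P \<and> (\<forall>x\<in>U. \<exists>V\<in>N x. V \<subseteq> U))"
    unfolding istopology_def
  proof (intro conjI allI impI)
    fix S T assume S: "S \<subseteq> P \<and> (\<forall>x\<in>S. \<exists>V\<in>N x. V \<subseteq> S)" and T: "T \<subseteq> P \<and> (\<forall>x\<in>T. \<exists>V\<in>N x. V \<subseteq> T)"
    show "S \<inter> T \<subseteq> P" using S by blast
    show "\<forall>x\<in>S \<inter> T. \<exists>V\<in>N x. V \<subseteq> S \<inter> T"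
    proof
      fix x assume x: "x \<in> S \<inter> T"
      then obtain V V' where V: "V \<in> N x" "V \<subseteq> S" "V' \<in> N x" "V' \<subseteq> T" using S T by blast
      moreover obtain W where "W \<in> N x" "W \<subseteq> V \<inter> V'" using N_dir[of x V V'] x S V by auto
      ultimately show "\<exists>V\<in>N x. V \<subseteq> S \<inter> T" by (intro bexI[of _ W]) auto
    qed
  next
    fix \<K> :: "'p set set" assume K: "\<forall>K\<in>\<K>. K \<subseteq> P \<and> (\<forall>x\<in>K. \<exists>V\<in>N x. V \<subseteq> K)"
    show "\<Union>\<K> \<subseteq> P" using K by blast
    show "\<forall>x\<in>\<Union>\<K>. \<exists>V\<in>N x. V \<subseteq> \<Union>\<K>"
    proof
      fix x assume "x \<in> \<Union>\<K>"
      then obtain L where L: "L \<in> \<K>" "x \<in> L" by blast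
      then obtain V where "V \<in> N x" "V \<subseteq> L" using K by blast
      then show "\<exists>V\<in>N x. V \<subseteq> \<Union>\<K>" using L by (intro bexI[of _ V]) auto
    qed
  qed
  from topology_inverse'[OF this] show ?thesis unfolding nbhd_topology_def by (rule fun_cong)
qed

lemma topspace_X [simp]: "topspace X = P"
proof -
  have "openin X P" using N_nonempty N_mem by (auto simp: openin_iff)
  then show ?thesis by (metis openin_iff openin_subset openin_topspace subset_antisym)
qed

lemma N_open: "x \<in> P \<Longrightarrow> V \<in> N x \<Longrightarrow> openin X V"
  unfolding openin_iff by (metis N_below N_mem N_nonempty order_refl subsetD)

lemma openE: "openin X U \<Longrightarrow> x \<in> U \<Longrightarrow> \<exists>V\<in>N x. V \<subseteq> U"
  by (simp add: openin_iff)

lemma N_avoid: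
  assumes "x \<in> P" "y \<noteq> x" shows "\<exists>V\<in>N x. y \<notin> V"
proof -
  obtain W :: "nat \<Rightarrow> 'p set" where "\<forall>n. W n \<in> N x" "(\<Inter>n. W n) = {x}" using N_seq assms(1) by blast
  then show ?thesis using assms(2) by blast
qed

section \<open>Separation and covering properties of tree-like spaces\<close>

lemma Hausdorff_X: "Hausdorff_space X"
proof -
  have *: "\<exists>U V. openin X U \<and> openin X V \<and> x \<in> U \<and> y \<in> V \<and> disjnt U V"
    if "x \<in> P" "y \<in> P" "x \<noteq> y" "d x \<le> d y" for x y
  proof -
    obtain V where V: "V \<in> N x" "y \<notin> V" using N_avoid \<open>x \<in> P\<close> \<open>x \<noteq> y\<close> by metis
    obtain V' where V': "V' \<in> N y" using N_nonempty \<open>y \<in> P\<close> by blast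
    \<comment> \<open>No neighbourhood of a point contains a different point of smaller or equal
      depth. So \<open>V'\<close> is arbitrary and only \<open>V\<close> has to avoid
      \<open>y\<close>; \<open>N_meet\<close> then makes them disjoint.\<close>
    have "x \<notin> V'" using N_depth[OF \<open>y \<in> P\<close> V', of x] that by auto
    then have "disjnt V V'" using N_meet that V V' unfolding disjnt_def by blast
    moreover have "x \<in> V" "y \<in> V'" "openin X V" "openin X V'" using N_open N_mem that V V' by auto
    ultimately show ?thesis by blast
  qed
  show ?thesis
    unfolding Hausdorff_space_def topspace_X
  proof (intro allI impI, elim conjE)
    fix x y assume "x \<in> P" "y \<in> P" "x \<noteq> y"
    then show "\<exists>U V. openin X U \<and> openin X V \<and> x \<in> U \<and> y \<in> V \<and> disjnt U V"
      using *[of x y] *[of y x] unfolding disjnt_def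
      by (cases "d x \<le> d y") (simp, metis Int_commute nat_le_linear)
  qed
qed

text \<open>Among the chosen neighbourhoods only those of points lying in no other chosen
  neighbourhood are kept; the tree structure makes the kept ones pairwise disjoint.\<close>

lemma disjoint_open_refinement:
  assumes "\<And>U. U \<in> \<U> \<Longrightarrow> openin X U"
  obtains \<V> where "\<And>V. V \<in> \<V> \<Longrightarrow> openin X V" "\<Union>\<V> = \<Union>\<U>" "\<And>V. V \<in> \<V> \<Longrightarrow> \<exists>U\<in>\<U>. V \<subseteq> U"
    "pairwise disjnt \<V>"
proof -
  have UP: "\<Union>\<U> \<subseteq> P" using assms openin_iff by blast
  have "\<forall>x\<in>\<Union>\<U>. \<exists>V\<in>N x. \<exists>U\<in>\<U>. V \<subseteq> U" using assms openE by (meson UnionE)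
  then obtain v where v: "\<And>x. x \<in> \<Union>\<U> \<Longrightarrow> v x \<in> N x \<and> (\<exists>U\<in>\<U>. v x \<subseteq> U)" by metis
  define K where "K = {x\<in>\<Union>\<U>. \<forall>y\<in>\<Union>\<U>. x \<in> v y \<longrightarrow> y = x}"
  have KP: "x \<in> \<Union>\<U>" "x \<in> P" "v x \<in> N x" if "x \<in> K" for x using that UP v unfolding K_def by auto
  show ?thesis
  proof
    show "openin X V" if "V \<in> v ` K" for V
      using that KP N_open by blast
    show "\<exists>U\<in>\<U>. V \<subseteq> U" if "V \<in> v ` K" for V using that KP v by blast
    then have "\<Union>(v ` K) \<subseteq> \<Union>\<U>" by blast
    moreover have "\<Union>\<U> \<subseteq> \<Union>(v ` K)"
    proof
      fix x assume x: "x \<in> \<Union>\<U>"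
      \<comment> \<open>Of the centres whose chosen neighbourhood contains \<open>x\<close>, one of
        least depth lies in no other chosen neighbourhood: the centre of such a neighbourhood would
        be shallower, and by \<open>N_below\<close> it would capture \<open>x\<close> as
        well.\<close>
      have "\<exists>t. (t \<in> \<Union>\<U> \<and> x \<in> v t) \<and> (\<forall>s. (s \<in> \<Union>\<U> \<and> x \<in> v s) \<longrightarrow> d t \<le> d s)"
        by (rule ex_has_least_nat[of _ x]) (use x N_mem v UP in blast)
      then obtain t where t: "t \<in> \<Union>\<U>" "x \<in> v t" "\<And>s. s \<in> \<Union>\<U> \<Longrightarrow> x \<in> v s \<Longrightarrow> d t \<le> d s"
        by blast
      have "y = t" if y: "y \<in> \<Union>\<U>" "t \<in> v y" for y
      proof (rule ccontr)
        assume "y \<noteq> t"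
        then have "v t \<subseteq> v y" "d y < d t"
          using N_below[of y "v y" t "v t"] N_depth[of y "v y" t] y v t(1) UP by blast+
        then show False using t y by (meson leD subsetD)
      qed
      then have "t \<in> K" using t unfolding K_def by blast
      then show "x \<in> \<Union>(v ` K)" using t by blast
    qed
    ultimately show "\<Union>(v ` K) = \<Union>\<U>" by blast
    show "pairwise disjnt (v ` K)"
    proof (rule pairwiseI)
      fix A B assume "A \<in> v ` K" "B \<in> v ` K" "A \<noteq> B"
      then obtain x y where xy: "x \<in> K" "y \<in> K" "A = v x" "B = v y" "x \<noteq> y" by blast
      then have "y \<notin> v x" "x \<notin> v y" using KP unfolding K_def by blast+
      then show "disjnt A B" using N_meet[of x y "v x" "v y"] KP xy unfolding disjnt_def by blast
    qed
  qed
qed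

text \<open>A disjoint open refinement of the cover by \<open>U\<close> and \<open>P - A\<close> is
  a partition. The blocks meeting \<open>A\<close> lie in \<open>U\<close>, and their union is
  clopen because the other blocks make up its complement.\<close>

lemma clopen_between:
  assumes "closedin X A" "openin X U" "A \<subseteq> U"
  shows "\<exists>V. openin X V \<and> closedin X V \<and> A \<subseteq> V \<and> V \<subseteq> U"
proof -
  have op: "openin X W" if "W \<in> {U, P - A}" for W using that assms by (auto simp: closedin_def)
  obtain \<V> where \<V>: "\<And>V. V \<in> \<V> \<Longrightarrow> openin X V" "\<Union>\<V> = \<Union>{U, P - A}"
    "\<And>V. V \<in> \<V> \<Longrightarrow> \<exists>W\<in>{U, P - A}. V \<subseteq> W" "pairwise disjnt \<V>"
    using disjoint_open_refinement[of "{U, P - A}"] op by metis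
  have AP: "A \<subseteq> P" "U \<subseteq> P" using assms by (auto simp: closedin_def openin_iff)
  then have cov: "\<Union>\<V> = P" unfolding \<V>(2) using assms(3) by auto
  let ?V = "\<Union>{V\<in>\<V>. V \<inter> A \<noteq> {}}" and ?W = "\<Union>{V\<in>\<V>. V \<inter> A = {}}"
  have "openin X ?V" "openin X ?W" using \<V>(1) by blast+
  moreover have "P - ?V = ?W" (is "_ = ?R")
  proof
    show "P - ?V \<subseteq> ?R" using cov by blast
    show "?R \<subseteq> P - ?V"
    proof
      fix x assume "x \<in> ?R"
      then obtain V where V: "V \<in> \<V>" "V \<inter> A = {}" "x \<in> V" by blast
      have "V' = V" if "V' \<in> \<V>" "x \<in> V'" for V'
        using pairwiseD[OF \<V>(4) that(1) V(1)] V(3) that(2) unfolding disjnt_def by blast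
      then show "x \<in> P - ?V" using V cov by blast
    qed
  qed
  moreover have "?V \<subseteq> P" using cov by blast
  ultimately have "closedin X ?V" by (simp add: closedin_def)
  moreover have "A \<subseteq> ?V" using AP cov by blast
  moreover have "?V \<subseteq> U" using \<V>(3) by blast
  ultimately show ?thesis using \<open>openin X ?V\<close> by blast
qed

lemma normal_X: "normal_space X"
  unfolding normal_space_def
proof (intro allI impI, elim conjE)
  fix S T assume S: "closedin X S" and T: "closedin X T" and "disjnt S T"
  then have "S \<subseteq> P - T" "openin X (P - T)"
    by (auto simp: closedin_def disjnt_def)
  then obtain V where V: "openin X V" "closedin X V" "S \<subseteq> V" "V \<subseteq> P - T"
    using clopen_between S by metis
  then have "openin X (P - V)" "T \<subseteq> P - V" using T by (auto simp: closedin_def)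
  then show "\<exists>U V. openin X U \<and> openin X V \<and> S \<subseteq> U \<and> T \<subseteq> V \<and> disjnt U V"
    using V unfolding disjnt_def by (metis Diff_disjoint)
qed

lemma strongly_zero_dimensional_X: "strongly_zero_dimensional_space X"
  unfolding strongly_zero_dimensional_space_def
  using Hausdorff_X normal_X clopen_between by blast

text \<open>\<open>disjoint_open_refinement\<close> does not ask the family to cover the space,
  which is what subspaces need: a cover of \<open>S\<close> is lifted to open sets of
  \<open>X\<close>, refined disjointly and traced on \<open>S\<close>. Local finiteness holds
  because the block around a point meets no other block.\<close>

lemma hereditarily_paracompact_X: "hereditarily_paracompact_space X"
  unfolding hereditarily_paracompact_space_def paracompact_space_def
proof (intro allI impI conjI)
  fix S assume "S \<subseteq> topspace X"
  then have S: "topspace (subtopology X S) = S" by auto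
  show "Hausdorff_space (subtopology X S)" by (simp add: Hausdorff_X Hausdorff_space_subtopology)
  fix \<U> assume U: "(\<forall>U\<in>\<U>. openin (subtopology X S) U) \<and> \<Union>\<U> = topspace (subtopology X S)"
  define \<W> where "\<W> = {W. openin X W \<and> W \<inter> S \<in> \<U>}"
  then have Wop: "openin X W" if "W \<in> \<W>" for W using that by blast
  obtain \<V> where \<V>: "\<And>V. V \<in> \<V> \<Longrightarrow> openin X V" "\<Union>\<V> = \<Union>\<W>" "\<And>V. V \<in> \<V> \<Longrightarrow> \<exists>U\<in>\<W>. V \<subseteq> U"
    "pairwise disjnt \<V>"
    using disjoint_open_refinement[of \<W>] Wop by metis
  have cov: "S \<subseteq> \<Union>\<V>"
  proof
    fix x assume "x \<in> S"
    then obtain U where "x \<in> U" "U \<in> \<U>" using U S by blast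
    moreover obtain W where "openin X W" "U = W \<inter> S"
      using U \<open>U \<in> \<U>\<close> by (auto simp: openin_subtopology)
    ultimately have "W \<in> \<W>" "x \<in> W" by (auto simp: \<W>_def)
    then show "x \<in> \<Union>\<V>" unfolding \<V>(2) by (rule UnionI)
  qed
  let ?V = "(\<lambda>V. V \<inter> S) ` \<V>"
  have "\<exists>U\<in>\<U>. V \<subseteq> U" if "V \<in> ?V" for V
  proof -
    obtain V' where V': "V' \<in> \<V>" "V = V' \<inter> S" using \<open>V \<in> ?V\<close> by blast
    then obtain W where W: "W \<in> \<W>" "V' \<subseteq> W" using \<V>(3)[OF V'(1)] by blast
    then have "W \<inter> S \<in> \<U>" by (simp add: \<W>_def)
    then show ?thesis using V' W by (intro bexI[of _ "W \<inter> S"]) auto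
  qed
  moreover have "locally_finite_in (subtopology X S) ?V"
    unfolding locally_finite_in_def S
  proof (intro conjI ballI)
    show "\<Union>?V \<subseteq> S" by blast
    fix x assume x: "x \<in> S"
    then obtain V where V: "V \<in> \<V>" "x \<in> V" using cov by blast
    have "{U \<in> ?V. U \<inter> (V \<inter> S) \<noteq> {}} \<subseteq> {V \<inter> S}"
      using V \<V>(4) unfolding pairwise_def disjnt_def by blast
    then have "finite {U \<in> ?V. U \<inter> (V \<inter> S) \<noteq> {}}" using finite_subset by blast
    moreover have "openin (subtopology X S) (V \<inter> S)" using V \<V>(1) by (auto simp: openin_subtopology)
    ultimately show "\<exists>V. openin (subtopology X S) V \<and> x \<in> V \<and> finite {U \<in> ?V. U \<inter> V \<noteq> {}}"
      using V x by blast
  qed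
  moreover have "\<forall>V\<in>?V. openin (subtopology X S) V" using \<V>(1) by (auto simp: openin_subtopology)
  moreover have "\<Union>?V = topspace (subtopology X S)" unfolding S using cov by blast
  ultimately show "\<exists>\<V>. (\<forall>V\<in>\<V>. openin (subtopology X S) V) \<and> \<Union>\<V> = topspace (subtopology X S) \<and>
             (\<forall>V\<in>\<V>. \<exists>U\<in>\<U>. V \<subseteq> U) \<and> locally_finite_in (subtopology X S) \<V>"
    by blast
qed

text \<open>\<open>G n\<close> is the union of the \<open>n\<close>-th neighbourhoods of the points
  of \<open>C\<close>. The centres in \<open>C\<close> that ever capture a point \<open>t\<close>
  outside \<open>C\<close> have distinct depths below \<open>d t\<close>, so they are finite in
  number; as the neighbourhoods decrease, from some stage on none of them captures
  \<open>t\<close>.\<close>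

lemma gdelta_any:
  assumes "C \<subseteq> P" shows "gdelta_in X C"
proof -
  obtain W :: "'p \<Rightarrow> nat \<Rightarrow> 'p set"
    where W: "\<And>x. x \<in> P \<Longrightarrow> (\<forall>n. W x n \<in> N x) \<and> decseq (W x) \<and> (\<Inter>n. W x n) = {x}"
    using N_seq by metis
  define G where "G n = (\<Union>x\<in>C. W x n)" for n
  have op: "openin X (G n)" for n
    unfolding G_def using W assms N_open by (intro openin_Union) auto
  have "C = (\<Inter>n. G n)"
  proof
    show "C \<subseteq> (\<Inter>n. G n)" unfolding G_def using W assms by blast
    show "(\<Inter>n. G n) \<subseteq> C"
    proof (rule ccontr)
      assume "\<not> ?thesis"
      then obtain t where t: "\<And>n. t \<in> G n" "t \<notin> C" by blast
      define A where "A = {x\<in>C. \<exists>n. t \<in> W x n}"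
      have *: "d x < d t" if "x \<in> A" for x
        using that W[of x] N_depth[of x _ t] assms t(2) unfolding A_def by blast
      have "inj_on d A"
      proof (rule inj_onI)
        fix x y assume xy: "x \<in> A" "y \<in> A" "d x = d y"
        then obtain m n where mn: "t \<in> W x m" "t \<in> W y n" unfolding A_def by blast
        have P: "x \<in> P" "y \<in> P" "W x m \<in> N x" "W y n \<in> N y" using xy assms W unfolding A_def by auto
        then have "y \<in> W x m \<or> x \<in> W y n" using N_meet mn by blast
        then show "x = y" using N_depth P xy(3) by (metis nat_less_le)
      qed
      moreover have "d ` A \<subseteq> {..<d t}" using * by blast
      ultimately have fin: "finite A" by (meson finite_imageD finite_lessThan finite_subset)
      have "\<forall>x\<in>A. \<exists>n. t \<notin> W x n" using W assms t(2) unfolding A_def by blast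
      then obtain n where n: "\<And>x. x \<in> A \<Longrightarrow> t \<notin> W x (n x)" by metis
      obtain m where m: "\<And>x. x \<in> A \<Longrightarrow> n x \<le> m"
        using fin by (meson finite_imageI finite_nat_set_iff_bounded_le imageI)
      obtain x where x: "x \<in> C" "t \<in> W x m" using t(1)[of m] unfolding G_def by blast
      then have "x \<in> A" unfolding A_def by blast
      moreover have "W x m \<subseteq> W x (n x)"
        using m[OF \<open>x \<in> A\<close>] W[of x] x(1) assms decseqD[of "W x"] by (simp add: subsetD)
      ultimately have "t \<in> W x (n x)" using x(2) by blast
      then show False using n \<open>x \<in> A\<close> by blast
    qed
  qed
  moreover have "gdelta_in X (\<Inter>n. G n)"
    by (rule gdelta_in_Inter) (auto intro: open_imp_gdelta_in op)
  ultimately show ?thesis by simp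
qed

lemma perfectly_normal_X: "perfectly_normal_space X"
  unfolding perfectly_normal_space_def
  using Hausdorff_X normal_X gdelta_any by (auto simp: closedin_def)

lemma scattered_X: "scattered_space X"
  unfolding scattered_space_def topspace_X
proof (intro allI impI, elim conjE)
  fix A assume A: "A \<subseteq> P" "A \<noteq> {}"
  then obtain x V where xV: "x \<in> A" "V \<in> N x" "V \<inter> A = {x}" using N_scat[of A] by auto
  then have "openin X V" using N_open A by blast
  then have "openin (subtopology X A) (V \<inter> A)" unfolding openin_subtopology by blast
  then show "\<exists>x\<in>A. openin (subtopology X A) {x}" using xV by metis
qed

lemma topology_base_N: "topology_base X (\<Union>x\<in>P. N x)"
  unfolding topology_base_def openin_topology_base_unique
proof (intro conjI allI impI)
  show "openin X V" if "V \<in> (\<Union>x\<in>P. N x)" for V using that N_open by blast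
  show "\<exists>V. V \<in> (\<Union>x\<in>P. N x) \<and> x \<in> V \<and> V \<subseteq> U" if "openin X U \<and> x \<in> U" for U x
  proof -
    obtain V where V: "V \<in> N x" "V \<subseteq> U" using openE \<open>openin X U \<and> x \<in> U\<close> by blast
    have x: "x \<in> P" using that openin_subset[of X U] by auto
    have "V \<in> (\<Union>x\<in>P. N x)" using x V(1) by (rule UN_I)
    moreover have "x \<in> V" using N_mem[OF x V(1)] by (rule conjunct1)
    ultimately show ?thesis using V(2) by blast
  qed
qed

end

section \<open>Transport along injections and disjoint sums\<close>

lemma nbhd_tree_image:
  assumes "nbhd_tree P N d" and g: "inj_on g P"
  shows "nbhd_tree (g ` P) (\<lambda>y. (`) g ` N (inv_into P g y)) (\<lambda>y. d (inv_into P g y))"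
proof -
  interpret nbhd_tree P N d by fact
  have inv: "inv_into P g (g x) = x" if "x \<in> P" for x using g that by (rule inv_into_f_f)
  have NP: "V \<subseteq> P" if "x \<in> P" "V \<in> N x" for x V using N_mem that by blast
  show ?thesis
  proof
    fix y V y' V'
    assume y: "y \<in> g ` P" and V: "V \<in> (`) g ` N (inv_into P g y)"
    then obtain x W where x: "x \<in> P" "y = g x" and W: "W \<in> N x" "V = g ` W" using inv by auto
    show "y \<in> V \<and> V \<subseteq> g ` P" using N_mem x W by blast
    show "\<exists>W\<in>(`) g ` N (inv_into P g y). W \<subseteq> V \<inter> V'" if "V' \<in> (`) g ` N (inv_into P g y)"
    proof -
      obtain W' where W': "W' \<in> N x" "V' = g ` W'" using \<open>V' \<in> _\<close> x inv by auto
      obtain W'' where "W'' \<in> N x" "W'' \<subseteq> W \<inter> W'" using N_dir[OF x(1) W(1) W'(1)] by blast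
      then show ?thesis using W W' x inv by (intro bexI[of _ "g ` W''"]) auto
    qed
    show "d (inv_into P g y) < d (inv_into P g y')" if y': "y' \<in> V" "y' \<noteq> y"
    proof -
      obtain x' where "x' \<in> W" "y' = g x'" using y' W by blast
      moreover from this have "x' \<in> P" using NP[OF x(1) W(1)] by blast
      ultimately show ?thesis using N_depth[OF x(1) W(1), of x'] x y'(2) inv by auto
    qed
    show "V' \<subseteq> V" if y': "y' \<in> V" "y' \<noteq> y" "V' \<in> (`) g ` N (inv_into P g y')"
    proof -
      obtain x' where x': "x' \<in> W" "y' = g x'" using y' W by blast
      then have "inv_into P g y' = x'" "x' \<noteq> x" using NP[OF x(1) W(1)] inv y' x by auto
      then obtain W' where "W' \<in> N x'" "V' = g ` W'" using y'(3) by blast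
      then show ?thesis using N_below[OF x(1) W(1) x'(1) \<open>x' \<noteq> x\<close>] W by blast
    qed
    show "y' \<in> V \<or> y \<in> V'"
      if y': "y' \<in> g ` P" "V' \<in> (`) g ` N (inv_into P g y')" "V \<inter> V' \<noteq> {}"
    proof -
      obtain x' W' where x': "x' \<in> P" "y' = g x'" and W': "W' \<in> N x'" "V' = g ` W'"
        using y'(1,2) inv by (metis (no_types, lifting) imageE)
      have "W \<inter> W' \<noteq> {}"
        using y'(3) inj_on_image_Int[OF g NP[OF x(1) W(1)] NP[OF x'(1) W'(1)]] W W' by auto
      then have "x' \<in> W \<or> x \<in> W'" by (rule N_meet[OF x(1) x'(1) W(1) W'(1)])
      then show ?thesis using x x' W W' by blast
    qed
  next
    fix y assume "y \<in> g ` P"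
    then obtain x where x: "x \<in> P" "y = g x" by blast
    obtain W :: "nat \<Rightarrow> 'a set" where W: "\<And>n. W n \<in> N x" "decseq W" "(\<Inter>n. W n) = {x}"
      using N_seq[OF x(1)] by blast
    have "decseq (\<lambda>n. g ` W n)" using W(2) unfolding decseq_def by blast
    moreover have "(\<Inter>n. g ` W n) = g ` (\<Inter>n. W n)"
      using NP[OF x(1) W(1)] by (intro image_INT[OF g, symmetric]) auto
    then have "(\<Inter>n. g ` W n) = {y}" using W(3) x by simp
    moreover have "g ` W n \<in> (`) g ` N (inv_into P g y)" for n using W(1) x inv by auto
    ultimately show "\<exists>W::nat \<Rightarrow> 'b set. (\<forall>n. W n \<in> (`) g ` N (inv_into P g y)) \<and> decseq W \<and> (\<Inter>n. W n) = {y}"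
      by (intro exI[of _ "\<lambda>n. g ` W n"]) simp
  next
    fix C assume C: "C \<subseteq> g ` P" "C \<noteq> {}"
    obtain D where D: "D \<subseteq> P" "C = g ` D" using C(1) by (auto simp: subset_image_iff)
    then obtain x V where xV: "x \<in> D" "V \<in> N x" "V \<inter> D = {x}" using C(2) N_scat[of D] by auto
    have "g ` V \<inter> C = g ` (V \<inter> D)"
      using inj_on_image_Int[OF g, of V D] NP[OF _ xV(2)] xV(1) D by auto
    then have "g ` V \<inter> C = {g x}" using xV(3) by simp
    then show "\<exists>x\<in>C. \<exists>V\<in>(`) g ` N (inv_into P g x). V \<inter> C = {x}"
      using xV D inv by (intro bexI[of _ "g x"] bexI[of _ "g ` V"]) auto
  qed
qed

text \<open>Each neighbourhood stays within its own summand, so depths from different summands are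
  never compared.\<close>

lemma nbhd_tree_Un:
  assumes "nbhd_tree P N d" "nbhd_tree P' N' d'" and disj: "P \<inter> P' = {}"
  shows "nbhd_tree (P \<union> P') (\<lambda>x. if x \<in> P then N x else N' x) (\<lambda>x. if x \<in> P then d x else d' x)"
proof -
  interpret A: nbhd_tree P N d by fact
  interpret B: nbhd_tree P' N' d' by fact
  have AP: "V \<subseteq> P" if "x \<in> P" "V \<in> N x" for x V using A.N_mem that by blast
  have BP: "V \<subseteq> P'" if "x \<in> P'" "V \<in> N' x" for x V using B.N_mem that by blast
  let ?N = "\<lambda>x. if x \<in> P then N x else N' x" and ?d = "\<lambda>x. if x \<in> P then d x else d' x"
  show ?thesis
  proof
    fix x V y V'
    assume x: "x \<in> P \<union> P'" and V: "V \<in> ?N x"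
    consider (A) "x \<in> P" "V \<in> N x" "V \<subseteq> P" | (B) "x \<in> P'" "x \<notin> P" "V \<in> N' x" "V \<subseteq> P'"
      using x V disj AP BP by (cases "x \<in> P") auto
    note cases = this
    show "x \<in> V \<and> V \<subseteq> P \<union> P'"
      by (cases rule: cases) (use A.N_mem B.N_mem in blast)+
    show "\<exists>W\<in>?N x. W \<subseteq> V \<inter> V'" if "V' \<in> ?N x"
      by (cases rule: cases) (use A.N_dir[of x V V'] B.N_dir[of x V V'] that in auto)
    show "V' \<subseteq> V" if "y \<in> V" "y \<noteq> x" "V' \<in> ?N y"
    proof (cases rule: cases)
      case A
      then have "y \<in> P" using that by blast
      then show ?thesis using A.N_below[OF A(1,2) that(1,2)] that by simp
    next
      case B
      then have "y \<notin> P" using that disj by blast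
      then show ?thesis using B.N_below[OF B(1,3) that(1,2)] that by auto
    qed
    show "?d x < ?d y" if "y \<in> V" "y \<noteq> x"
    proof (cases rule: cases)
      case A
      then have "y \<in> P" using that by blast
      then show ?thesis using A.N_depth[OF A(1,2) that] A by simp
    next
      case B
      then have "y \<notin> P" using that disj by blast
      then show ?thesis using B.N_depth[OF B(1,3) that] B by auto
    qed
    show "y \<in> V \<or> x \<in> V'" if y: "y \<in> P \<union> P'" "V' \<in> ?N y" "V \<inter> V' \<noteq> {}"
    proof -
      consider (C) "y \<in> P" "V' \<in> N y" "V' \<subseteq> P" | (D) "y \<in> P'" "y \<notin> P" "V' \<in> N' y" "V' \<subseteq> P'"
        using y disj AP BP by (cases "y \<in> P") auto
      then show ?thesis
      proof cases
        case C
        show ?thesis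
          by (cases rule: cases) (use A.N_meet[of x y V V'] C disj y(3) in blast)+
      next
        case D
        show ?thesis
          by (cases rule: cases) (use B.N_meet[of x y V V'] D disj y(3) in blast)+
      qed
    qed
  next
    fix x assume "x \<in> P \<union> P'"
    then show "\<exists>W::nat \<Rightarrow> 'a set. (\<forall>n. W n \<in> ?N x) \<and> decseq W \<and> (\<Inter>n. W n) = {x}"
      using A.N_seq[of x] B.N_seq[of x] by (cases "x \<in> P") auto
  next
    fix C assume C: "C \<subseteq> P \<union> P'" "C \<noteq> {}"
    show "\<exists>x\<in>C. \<exists>V\<in>?N x. V \<inter> C = {x}"
    proof (cases "C \<inter> P = {}")
      case False
      then obtain x V where x: "x \<in> C \<inter> P" "V \<in> N x" "V \<inter> (C \<inter> P) = {x}"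
        using A.N_scat[of "C \<inter> P"] by auto
      moreover have "V \<subseteq> P" using AP x by blast
      ultimately show ?thesis by (intro bexI[of _ x] bexI[of _ V]) auto
    next
      case True
      then have "C \<subseteq> P'" using C by blast
      then obtain x V where x: "x \<in> C" "V \<in> N' x" "V \<inter> C = {x}"
        using B.N_scat[of C] C by auto
      then show ?thesis using True by (intro bexI[of _ x] bexI[of _ V]) auto
    qed
  qed
qed

section \<open>Cardinality and independent families\<close>

lemma finite_ordLeq_infinite: "finite A \<Longrightarrow> infinite B \<Longrightarrow> |A| \<le>o |B|"
  by (meson card_of_ordLeq_finite card_of_Well_order ordLeq_total)

text \<open>\<open>I\<close> is the union of the fibres over \<open>B\<close>. Finite fibres force
  \<open>B\<close> to be infinite, and a union of \<open>|B|\<close> finite sets then has at most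
  \<open>|B|\<close> elements.\<close>

lemma finite_to_one_ordLeq:
  assumes "infinite I" "f ` I \<subseteq> B" "\<And>b. b \<in> B \<Longrightarrow> finite {i\<in>I. f i = b}"
  shows "|I| \<le>o |B|"
proof -
  have I: "I = (\<Union>b\<in>B. {i\<in>I. f i = b})" using assms(2) by blast
  then have B: "infinite B" using assms(1,3) by (metis (no_types, lifting) finite_UN_I)
  have "|\<Union>b\<in>B. {i\<in>I. f i = b}| \<le>o |B|"
  proof (rule card_of_UNION_ordLeq_infinite[OF B])
    show "|B| \<le>o |B|" by (simp add: card_of_mono1)
    show "\<forall>b\<in>B. |{i\<in>I. f i = b}| \<le>o |B|" using assms(3) B by (simp add: finite_ordLeq_infinite)
  qed
  then show ?thesis using I by simp
qed

text \<open>For the lower bound, choose in a given base a set \<open>f i\<close> with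
  \<open>p \<in> f i\<close> and \<open>f i \<subseteq> G i\<close>. By \<open>fin\<close> a single
  open set around \<open>p\<close> can serve only finitely many \<open>i\<close>, so
  \<open>f\<close> is finite-to-one.\<close>

lemma has_weightI:
  assumes "Card_order r" "infinite (Field r)" "topology_base X \<B>" "|\<B>| \<le>o r"
    and Op: "\<And>i. i \<in> Field r \<Longrightarrow> openin X (G i) \<and> p \<in> G i"
    and fin: "\<And>U. openin X U \<Longrightarrow> p \<in> U \<Longrightarrow> finite {i\<in>Field r. U \<subseteq> G i}"
  shows "has_weight X r"
proof -
  have low: "r \<le>o |\<C>|" if C: "topology_base X \<C>" for \<C>
  proof -
    have Cop: "openin X V" if "V \<in> \<C>" for V
      using C that unfolding topology_base_def openin_topology_base_unique by blast
    have Cb: "\<exists>V. V \<in> \<C> \<and> x \<in> V \<and> V \<subseteq> U" if "openin X U" "x \<in> U" for U x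
      using C that unfolding topology_base_def openin_topology_base_unique by simp
    have "\<forall>i\<in>Field r. \<exists>V. V \<in> \<C> \<and> p \<in> V \<and> V \<subseteq> G i"
      using Cb Op by simp
    then obtain f where f: "\<And>i. i \<in> Field r \<Longrightarrow> f i \<in> \<C> \<and> p \<in> f i \<and> f i \<subseteq> G i" by metis
    have "|Field r| \<le>o |\<C>|"
    proof (rule finite_to_one_ordLeq[OF assms(2)])
      show "f ` Field r \<subseteq> \<C>" using f by blast
      show "finite {i\<in>Field r. f i = b}" if "b \<in> \<C>" for b
      proof (cases "p \<in> b")
        case True
        have "{i\<in>Field r. f i = b} \<subseteq> {i\<in>Field r. b \<subseteq> G i}" using f by blast
        then show ?thesis using fin[OF Cop[OF that] True] finite_subset by blast
      next
        case False
        then have "{i\<in>Field r. f i = b} = {}" using f by blast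
        then show ?thesis by (metis finite.emptyI)
      qed
    qed
    then show ?thesis
      using assms(1) card_of_Field_ordIso ordIso_ordLeq_trans ordIso_symmetric by blast
  qed
  then show ?thesis
    unfolding has_weight_def using assms(3,4) ordIso_iff_ordLeq by blast
qed

section \<open>Lists, finite subsets and independent families\<close>

lemma card_of_lists_ordLeq:
  assumes "infinite A" shows "|lists A| \<le>o |A|"
proof -
  have "|{xs\<in>lists A. length xs = n}| \<le>o |A|" for n
  proof (induction n)
    case 0
    have "finite {xs\<in>lists A. length xs = 0}" by simp
    then show ?case using finite_ordLeq_infinite assms by blast
  next
    case (Suc n)
    have "{xs\<in>lists A. length xs = Suc n} \<subseteq> (\<lambda>(x, xs). x # xs) ` (A \<times> {xs\<in>lists A. length xs = n})"
      by (auto simp: length_Suc_conv image_iff)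
    then have "|{xs\<in>lists A. length xs = Suc n}| \<le>o |A \<times> {xs\<in>lists A. length xs = n}|"
      by (rule surj_imp_ordLeq)
    also have "|A \<times> {xs\<in>lists A. length xs = n}| \<le>o |A|"
      by (rule card_of_Sigma_ordLeq_infinite[OF assms card_of_mono1[OF subset_refl]]) (simp add: Suc)
    finally show ?case .
  qed
  then have "|\<Union>n. {xs\<in>lists A. length xs = n}| \<le>o |A|"
    using assms by (intro card_of_UNION_ordLeq_infinite) (auto simp: infinite_iff_card_of_nat)
  moreover have "(\<Union>n. {xs\<in>lists A. length xs = n}) = lists A" by auto
  ultimately show ?thesis by simp
qed

lemma card_of_Fpow_ordLeq:
  assumes "infinite A" shows "|Fpow A| \<le>o |A|"
proof -
  have "Fpow A \<subseteq> set ` lists A"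
    unfolding Fpow_def by (auto simp: image_iff) (metis finite_list in_listsI subsetD)
  from ordLeq_transitive[OF surj_imp_ordLeq[OF this] card_of_lists_ordLeq[OF assms]] show ?thesis .
qed

lemma ctwo_cexp_Pow: "ctwo ^c r =o |Pow (Field r)|"
  unfolding cexp_def ctwo_def Field_card_of by (rule ordIso_symmetric[OF card_of_Pow_Func])

text \<open>The classical Fichtenholz-Kantorovich-Hausdorff construction, carried over to \<open>M\<close> from
  \<open>Fpow M \<times> Fpow (Fpow M)\<close>.\<close>

lemma independent_family:
  assumes "infinite M" "|I| \<le>o |Pow M|"
  shows "\<exists>A. \<forall>F T. finite F \<longrightarrow> F \<subseteq> I \<longrightarrow> (\<exists>x\<in>M. \<forall>i\<in>F. x \<in> A i \<longleftrightarrow> i \<in> T)"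
proof -
  obtain e where e: "inj_on e I" "e ` I \<subseteq> Pow M"
    using assms(2) card_of_ordLeq by metis
  let ?D = "Fpow M \<times> Fpow (Fpow M)"
  have "infinite (Fpow M)"
  proof
    assume "finite (Fpow M)"
    moreover have "(\<lambda>x. {x}) ` M \<subseteq> Fpow M" by (auto simp: Fpow_def)
    ultimately have "finite ((\<lambda>x. {x}) ` M)" by (rule finite_subset[rotated])
    then show False using assms(1) by (simp add: finite_image_iff)
  qed
  then have "|Fpow (Fpow M)| \<le>o |M|"
    using card_of_Fpow_ordLeq[of "Fpow M"] card_of_Fpow_ordLeq[OF assms(1)] ordLeq_transitive by blast
  then have "|?D| \<le>o |M|"
    by (intro card_of_Sigma_ordLeq_infinite[OF assms(1) card_of_Fpow_ordLeq[OF assms(1)]]) simp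
  then obtain \<phi> where \<phi>: "inj_on \<phi> ?D" "\<phi> ` ?D \<subseteq> M" using card_of_ordLeq by metis
  define A where "A i = \<phi> ` {(G, H). (G, H) \<in> ?D \<and> e i \<inter> G \<in> H}" for i
  show ?thesis
  proof (intro exI[of _ A] allI impI)
    fix F T assume F: "finite F" "F \<subseteq> I"
    define g where "g i j = (SOME x. x \<in> (e i - e j) \<union> (e j - e i))" for i j
    have g: "g i j \<in> (e i - e j) \<union> (e j - e i)" if "i \<in> F" "j \<in> F" "i \<noteq> j" for i j
    proof -
      have "e i \<noteq> e j" using that F e by (auto dest: inj_onD)
      then have "\<exists>x. x \<in> (e i - e j) \<union> (e j - e i)" by blast
      then show ?thesis unfolding g_def by (rule someI_ex)
    qed
    \<comment> \<open>One separating point for every pair of distinct indices makes the traces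
      \<open>e i \<inter> G\<close> distinct for \<open>i \<in> F\<close>. With \<open>H\<close> the
      traces of the indices in \<open>T\<close>, the pair \<open>(G, H)\<close> is the required
      point.\<close>
    define G where "G = (\<lambda>(i, j). g i j) ` {(i, j). i \<in> F \<and> j \<in> F \<and> i \<noteq> j}"
    have "finite {(i, j). i \<in> F \<and> j \<in> F \<and> i \<noteq> j}"
      by (rule finite_subset[of _ "F \<times> F"]) (use F in auto)
    then have "finite G" unfolding G_def by blast
    moreover have "G \<subseteq> M"
    proof
      fix x assume "x \<in> G"
      then obtain i j where ij: "i \<in> F" "j \<in> F" "i \<noteq> j" "x = g i j" unfolding G_def by auto
      then have "x \<in> e i \<union> e j" using g[OF ij(1-3)] by blast
      then show "x \<in> M" using ij e(2) F(2) by blast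
    qed
    ultimately have G: "G \<in> Fpow M" by (simp add: Fpow_def)
    define H where "H = (\<lambda>i. e i \<inter> G) ` (F \<inter> T)"
    have H: "H \<in> Fpow (Fpow M)" using F G unfolding H_def Fpow_def by auto
    have sep: "i = j" if "i \<in> F" "j \<in> F" "e i \<inter> G = e j \<inter> G" for i j
    proof (rule ccontr)
      assume "i \<noteq> j"
      then have "g i j \<in> G" using that unfolding G_def by blast
      then show False using g[OF that(1,2) \<open>i \<noteq> j\<close>] that(3) by blast
    qed
    have "\<phi> (G, H) \<in> A i \<longleftrightarrow> i \<in> T" if "i \<in> F" for i
    proof -
      have "\<phi> (G, H) \<in> A i \<longleftrightarrow> e i \<inter> G \<in> H"
      proof
        assume "\<phi> (G, H) \<in> A i"
        then obtain G' H' where "(G', H') \<in> ?D" "e i \<inter> G' \<in> H'" "\<phi> (G, H) = \<phi> (G', H')"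
          unfolding A_def by blast
        then show "e i \<inter> G \<in> H" using inj_onD[OF \<phi>(1), of "(G, H)" "(G', H')"] G H by auto
      qed (use G H in \<open>auto simp: A_def\<close>)
      also have "\<dots> \<longleftrightarrow> i \<in> T" unfolding H_def using sep that by blast
      finally show ?thesis .
    qed
    moreover have "\<phi> (G, H) \<in> M" using \<phi> G H by blast
    ultimately show "\<exists>x\<in>M. \<forall>i\<in>F. x \<in> A i \<longleftrightarrow> i \<in> T" by blast
  qed
qed

section \<open>Ultrafilters\<close>

lemma ultrafilter_extension:
  assumes "\<S> \<subseteq> Pow M" and fip: "\<And>F. finite F \<Longrightarrow> F \<subseteq> \<S> \<Longrightarrow> M \<inter> \<Inter>F \<noteq> {}"
  obtains \<U> where "\<S> \<subseteq> \<U>" "\<U> \<subseteq> Pow M" "{} \<notin> \<U>" "\<And>A B. A \<in> \<U> \<Longrightarrow> B \<in> \<U> \<Longrightarrow> A \<inter> B \<in> \<U>"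
    "\<And>A. A \<subseteq> M \<Longrightarrow> A \<in> \<U> \<or> M - A \<in> \<U>"
proof -
  \<comment> \<open>Zorn's lemma is applied to families with the finite intersection property, not
    to filters; the filter laws come from maximality. The factor \<open>M\<close> covers the empty
    \<open>F\<close>, where \<open>\<Inter>F\<close> is \<open>UNIV\<close>.\<close>
  define Z where "Z = {\<T>. \<S> \<subseteq> \<T> \<and> \<T> \<subseteq> Pow M \<and> (\<forall>F. finite F \<longrightarrow> F \<subseteq> \<T> \<longrightarrow> M \<inter> \<Inter>F \<noteq> {})}"
  have "\<exists>\<U>\<in>Z. \<forall>\<T>\<in>Z. \<U> \<subseteq> \<T> \<longrightarrow> \<T> = \<U>"
  proof (rule subset_Zorn_nonempty)
    show "Z \<noteq> {}" using assms unfolding Z_def by blast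
    fix \<C> assume C: "\<C> \<noteq> {}" "subset.chain Z \<C>"
    then have CZ: "\<C> \<subseteq> Z" by (simp add: subset_chain_def)
    have "M \<inter> \<Inter>F \<noteq> {}" if F: "finite F" "F \<subseteq> \<Union>\<C>" for F
    proof -
      obtain T where T: "T \<in> \<C>" "F \<subseteq> T" using finite_subset_Union_chain[OF F C] by blast
      then have "T \<in> Z" using CZ by blast
      then show ?thesis using F(1) T(2) unfolding Z_def by simp
    qed
    moreover obtain T where "T \<in> \<C>" using C(1) by blast
    have ZM: "\<S> \<subseteq> T \<and> T \<subseteq> Pow M" if "T \<in> \<C>" for T using subsetD[OF CZ that] unfolding Z_def by simp
    then have "\<S> \<subseteq> \<Union>\<C>" using \<open>T \<in> \<C>\<close> by (meson Union_upper subset_trans)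
    moreover have "\<Union>\<C> \<subseteq> Pow M" using ZM by (simp add: Union_least)
    ultimately show "\<Union>\<C> \<in> Z" unfolding Z_def by simp
  qed
  then obtain \<U> where U: "\<U> \<in> Z" and max: "\<And>\<T>. \<T> \<in> Z \<Longrightarrow> \<U> \<subseteq> \<T> \<Longrightarrow> \<T> = \<U>" by metis
  have Ufip: "M \<inter> \<Inter>F \<noteq> {}" if "finite F" "F \<subseteq> \<U>" for F using U that unfolding Z_def by simp
  have UM: "\<S> \<subseteq> \<U>" "\<U> \<subseteq> Pow M" using U unfolding Z_def by auto
  \<comment> \<open>If no finite part of \<open>\<U>\<close> had an intersection missing
    \<open>A\<close>, adjoining \<open>A\<close> would keep the finite intersection property,
    against maximality.\<close>
  have ex: "\<exists>F. finite F \<and> F \<subseteq> \<U> \<and> M \<inter> \<Inter>F \<inter> A = {}" if A: "A \<subseteq> M" "A \<notin> \<U>" for A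
  proof (rule ccontr)
    assume no: "\<not> ?thesis"
    have "M \<inter> \<Inter>F \<noteq> {}" if F: "finite F" "F \<subseteq> insert A \<U>" for F
    proof -
      have "finite (F - {A})" "F - {A} \<subseteq> \<U>" using F by auto
      then have "M \<inter> \<Inter>(F - {A}) \<inter> A \<noteq> {}" using no by metis
      moreover have "M \<inter> \<Inter>(F - {A}) \<inter> A \<subseteq> M \<inter> \<Inter>F" by auto
      ultimately show ?thesis by (metis subset_empty)
    qed
    then have "insert A \<U> \<in> Z" using UM A unfolding Z_def by simp (metis subset_insertI2)
    then have "insert A \<U> = \<U>" using max by (meson subset_insertI)
    then show False using A by blast
  qed
  have dich: "A \<in> \<U> \<or> M - A \<in> \<U>" if A: "A \<subseteq> M" for A
  proof (rule ccontr)
    assume "\<not> ?thesis"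
    then obtain F F' where "finite F" "F \<subseteq> \<U>" "M \<inter> \<Inter>F \<inter> A = {}" "finite F'" "F' \<subseteq> \<U>" "M \<inter> \<Inter>F' \<inter> (M - A) = {}"
      using ex[of A] ex[of "M - A"] A by (metis Diff_subset)
    moreover from this have "M \<inter> \<Inter>(F \<union> F') = {}" unfolding Inter_Un_distrib by blast
    ultimately show False using Ufip[of "F \<union> F'"] by simp
  qed
  have "{} \<notin> \<U>" using Ufip[of "{{}}"] by auto
  moreover have "A \<inter> B \<in> \<U>" if AB: "A \<in> \<U>" "B \<in> \<U>" for A B
  proof (rule ccontr)
    assume "A \<inter> B \<notin> \<U>"
    moreover have "A \<inter> B \<subseteq> M" using AB UM by blast
    ultimately have "M - A \<inter> B \<in> \<U>" using dich by blast
    then show False using Ufip[of "{A, B, M - A \<inter> B}"] AB by auto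
  qed
  ultimately show ?thesis using UM dich that by metis
qed

section \<open>Almost discrete spaces from filters\<close>

text \<open>The \<open>A\<^sub>i\<^sup>S\<close> of the introductory text.\<close>

definition signed :: "'a set \<Rightarrow> ('b \<Rightarrow> 'a set) \<Rightarrow> 'b set \<Rightarrow> 'b \<Rightarrow> 'a set" where
  "signed M A S i = {x\<in>M. x \<in> A i \<longleftrightarrow> i \<in> S}"

definition independent_on :: "'a set \<Rightarrow> 'b set \<Rightarrow> ('b \<Rightarrow> 'a set) \<Rightarrow> bool" where
  "independent_on M I A \<longleftrightarrow> (\<forall>F T. finite F \<longrightarrow> F \<subseteq> I \<longrightarrow> (\<exists>x\<in>M. \<forall>i\<in>F. x \<in> A i \<longleftrightarrow> i \<in> T))"

text \<open>A filter base instead of a filter, so that it can have as few members as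
  \<open>I\<close>, which bounds the weight from above. The last two clauses bound it from below:
  the signed sets give neighbourhoods of the limit point, and each neighbourhood lies in only
  finitely many of them. The sequence \<open>W\<close> gives \<open>N_seq\<close> at the limit
  point.\<close>

definition coding_base :: "'a set \<Rightarrow> 'b set \<Rightarrow> ('b \<Rightarrow> 'a set) \<Rightarrow> 'b set \<Rightarrow> 'a set set \<Rightarrow> bool" where
  "coding_base M I A S B \<longleftrightarrow> B \<subseteq> Pow M \<and> {} \<notin> B \<and> (\<forall>b\<in>B. \<forall>c\<in>B. \<exists>e\<in>B. e \<subseteq> b \<inter> c) \<and>
     (\<exists>W :: nat \<Rightarrow> 'a set. (\<forall>n. W n \<in> B) \<and> decseq W \<and> (\<Inter>n. W n) = {}) \<and>
     (\<forall>i\<in>I. \<exists>b\<in>B. b \<subseteq> signed M A S i) \<and> (\<forall>b\<in>B. finite {i\<in>I. b \<subseteq> signed M A S i})"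

lemma independent_signed:
  assumes "independent_on M I A" "finite F" "finite G" "F \<subseteq> I" "G \<subseteq> I" "F \<inter> G = {}"
  shows "\<exists>x\<in>M. (\<forall>i\<in>F. x \<in> signed M A S i) \<and> (\<forall>i\<in>G. x \<notin> signed M A S i)"
proof -
  \<comment> \<open>The sign is kept for indices in \<open>F\<close> and reversed for those in
    \<open>G\<close>, hence \<open>G - S\<close>.\<close>
  have "\<exists>x\<in>M. \<forall>i\<in>F \<union> G. x \<in> A i \<longleftrightarrow> i \<in> (F \<inter> S) \<union> (G - S)"
    using assms(1)[unfolded independent_on_def, rule_format, of "F \<union> G" "(F \<inter> S) \<union> (G - S)"] assms by auto
  then show ?thesis using assms(6) unfolding signed_def by blast
qed

text \<open>\<open>b F\<close> is an intersection of finitely many signed sets minus one fixed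
  intersection, over the countable set \<open>range j\<close>. Removing the latter lets the
  \<open>b F\<close> for initial parts \<open>F\<close> of \<open>range j\<close> shrink to the
  empty set. Only finite subsets of \<open>I\<close> index the base, whence its size.\<close>

lemma coding_base_exists:
  assumes A: "independent_on M I A" and I: "infinite I"
  shows "\<exists>B. coding_base M I A S B \<and> |B| \<le>o |I|"
proof -
  obtain j :: "nat \<Rightarrow> 'b" where j: "inj j" "range j \<subseteq> I"
    using I infinite_countable_subset by metis
  let ?s = "signed M A S"
  define b where "b F = {x\<in>M. (\<forall>i\<in>F. x \<in> ?s i) \<and> \<not> (\<forall>n. x \<in> ?s (j n))}" for F
  let ?B = "b ` Fpow I"
  \<comment> \<open>Independence provides a point of all signed sets over \<open>F\<close> that
    avoids those of \<open>i\<close> and of some \<open>j n\<close> outside \<open>F\<close>;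
    missing the latter puts it into \<open>b F\<close>. So \<open>b F\<close> is nonempty and lies
    in no signed set with index outside \<open>F\<close>.\<close>
  have pt: "\<exists>x\<in>b F. x \<notin> ?s i" if F: "F \<in> Fpow I" "i \<in> I" "i \<notin> F" for F i
  proof -
    have "infinite (range j)" using j(1) by (simp add: finite_image_iff)
    moreover have "finite F" using F by (simp add: Fpow_def)
    ultimately obtain n where n: "j n \<notin> F" by (metis finite_subset image_subset_iff)
    moreover have "F \<subseteq> I" "{i, j n} \<subseteq> I" "F \<inter> {i, j n} = {}" using F j n by (auto simp: Fpow_def)
    ultimately obtain x where "x \<in> M" "\<forall>k\<in>F. x \<in> ?s k" "\<forall>k\<in>{i, j n}. x \<notin> ?s k"
      using independent_signed[OF A \<open>finite F\<close>, of "{i, j n}" S] by (metis finite.emptyI finite_insert)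
    then show ?thesis unfolding b_def by blast
  qed
  have "coding_base M I A S ?B"
    unfolding coding_base_def
  proof (intro conjI ballI)
    show "?B \<subseteq> Pow M" by (auto simp: b_def)
    show "{} \<notin> ?B"
    proof
      assume "{} \<in> ?B"
      then obtain F where F: "F \<in> Fpow I" "b F = {}" by blast
      then have "finite F" by (simp add: Fpow_def)
      then obtain i where "i \<in> I" "i \<notin> F" using I by (meson finite_subset subsetI)
      then show False using pt F by blast
    qed
    show "\<exists>e\<in>?B. e \<subseteq> c \<inter> c'" if "c \<in> ?B" "c' \<in> ?B" for c c'
    proof -
      obtain F F' where "c = b F" "c' = b F'" "F \<in> Fpow I" "F' \<in> Fpow I"
        using \<open>c \<in> ?B\<close> \<open>c' \<in> ?B\<close> by blast
      moreover from this have "F \<union> F' \<in> Fpow I" by (auto simp: Fpow_def)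
      moreover have "b (F \<union> F') \<subseteq> b F \<inter> b F'" by (auto simp: b_def)
      ultimately show ?thesis by blast
    qed
    let ?W = "\<lambda>n. b (j ` {..n})"
    have "?W n \<in> ?B" for n using j by (intro imageI) (auto simp: Fpow_def)
    moreover have "decseq ?W" unfolding decseq_def b_def by fastforce
    moreover have "(\<Inter>n. ?W n) = {}" unfolding b_def by blast
    ultimately show "\<exists>W::nat \<Rightarrow> 'a set. (\<forall>n. W n \<in> ?B) \<and> decseq W \<and> (\<Inter>n. W n) = {}"
      by (intro exI[of _ ?W]) simp
    show "\<exists>c\<in>?B. c \<subseteq> ?s i" if "i \<in> I" for i
      using that by (intro bexI[of _ "b {i}"]) (auto simp: b_def Fpow_def)
    show "finite {i\<in>I. c \<subseteq> ?s i}" if "c \<in> ?B" for c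
    proof -
      obtain F where F: "F \<in> Fpow I" "c = b F" using \<open>c \<in> ?B\<close> by blast
      then have "{i\<in>I. c \<subseteq> ?s i} \<subseteq> F" using pt by blast
      then show ?thesis using F by (auto simp: Fpow_def intro: finite_subset)
    qed
  qed
  moreover have "|?B| \<le>o |I|" by (rule ordLeq_transitive[OF card_of_image card_of_Fpow_ordLeq[OF I]])
  ultimately show ?thesis by blast
qed

text \<open>The last clause expresses maximality of the filter. Each \<open>c J\<close> with
  infinite \<open>J\<close> is put into the ultrafilter because a member contained in all signed
  sets over \<open>J\<close> would be disjoint from it; this gives the finiteness clause.\<close>

lemma coding_ultrafilter_exists:
  assumes A: "independent_on M I A" and I: "infinite I"
  shows "\<exists>B. coding_base M I A S B \<and> (\<forall>U\<subseteq>M. (\<forall>b\<in>B. U \<inter> b \<noteq> {}) \<longrightarrow> U \<in> B)"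
proof -
  let ?s = "signed M A S"
  define c where "c J = M - (\<Inter>i\<in>J. ?s i)" for J
  define \<S> where "\<S> = ?s ` I \<union> c ` {J. J \<subseteq> I \<and> infinite J}"
  have "M \<inter> \<Inter>F \<noteq> {}" if F: "finite F" "F \<subseteq> \<S>" for F
  proof -
    have "\<exists>F1\<subseteq>I. finite F1 \<and> F \<inter> ?s ` I = ?s ` F1"
      by (rule finite_subset_image) (use F in auto)
    then obtain F1 where F1: "F1 \<subseteq> I" "finite F1" "F \<inter> ?s ` I = ?s ` F1" by blast
    have "\<exists>F2\<subseteq>{J. J \<subseteq> I \<and> infinite J}. finite F2 \<and> F \<inter> c ` {J. J \<subseteq> I \<and> infinite J} = c ` F2"
      by (rule finite_subset_image) (use F in auto)
    then obtain F2 where F2': "F2 \<subseteq> {J. J \<subseteq> I \<and> infinite J}"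
      and F2'': "finite F2" "F \<inter> c ` {J. J \<subseteq> I \<and> infinite J} = c ` F2" by auto
    have "J \<subseteq> I \<and> infinite J" if "J \<in> F2" for J using subsetD[OF F2' that] by simp
    note F2 = this F2''
    \<comment> \<open>For each of the finitely many sets \<open>J\<close> take an index outside
      \<open>F1\<close>; a point of \<open>M\<close> missing the signed set of \<open>k J\<close>
      belongs to \<open>c J\<close>, so independence yields a common point.\<close>
    have "\<exists>i. i \<in> J - F1" if "J \<in> F2" for J
      using F2(1)[OF that] F1(2) Diff_infinite_finite by (metis finite.emptyI ex_in_conv)
    then obtain k where k: "\<And>J. J \<in> F2 \<Longrightarrow> k J \<in> J - F1" by metis
    have "k ` F2 \<subseteq> I" "F1 \<inter> k ` F2 = {}" using k F2(1) by auto
    then obtain x where x: "x \<in> M" "\<forall>i\<in>F1. x \<in> ?s i" "\<forall>i\<in>k ` F2. x \<notin> ?s i"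
      using independent_signed[OF A F1(2) finite_imageI[OF F2(2)] F1(1), of k S] by metis
    have "x \<in> B" if "B \<in> F" for B
    proof -
      have "B \<in> \<S>" using that F(2) by (rule subsetD[rotated])
      then have "B \<in> F \<inter> ?s ` I \<or> B \<in> F \<inter> c ` {J. J \<subseteq> I \<and> infinite J}"
        unfolding \<S>_def using that by simp
      then have "B \<in> ?s ` F1 \<or> B \<in> c ` F2" unfolding F1(3) F2(3) .
      then show ?thesis using x k unfolding c_def by blast
    qed
    then show ?thesis using x(1) by blast
  qed
  moreover have "\<S> \<subseteq> Pow M" by (auto simp: \<S>_def c_def signed_def)
  ultimately obtain \<U> where U: "\<S> \<subseteq> \<U>" "\<U> \<subseteq> Pow M" "{} \<notin> \<U>"
    and Uint: "\<And>A B. A \<in> \<U> \<Longrightarrow> B \<in> \<U> \<Longrightarrow> A \<inter> B \<in> \<U>"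
    and Uult: "\<And>A. A \<subseteq> M \<Longrightarrow> A \<in> \<U> \<or> M - A \<in> \<U>"
    using ultrafilter_extension[of \<S> M] by metis
  have sU: "?s i \<in> \<U>" if "i \<in> I" for i using U(1) that unfolding \<S>_def by blast
  have cU: "c J \<in> \<U>" if "J \<subseteq> I" "infinite J" for J using U(1) that unfolding \<S>_def by blast
  have "coding_base M I A S \<U>"
    unfolding coding_base_def
  proof (intro conjI ballI)
    show "\<exists>e\<in>\<U>. e \<subseteq> b \<inter> b'" if "b \<in> \<U>" "b' \<in> \<U>" for b b' using Uint that by blast
    show "\<exists>b\<in>\<U>. b \<subseteq> ?s i" if "i \<in> I" for i using sU that by blast
    show "finite {i\<in>I. b \<subseteq> ?s i}" if b: "b \<in> \<U>" for b
    proof (rule ccontr)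
      assume inf: "infinite {i\<in>I. b \<subseteq> ?s i}"
      let ?J = "{i\<in>I. b \<subseteq> ?s i}"
      have "b \<inter> c ?J \<in> \<U>" using Uint[OF b cU[OF _ inf]] by blast
      moreover have "b \<inter> c ?J = {}" unfolding c_def by blast
      ultimately show False using U(3) by simp
    qed
    obtain j :: "nat \<Rightarrow> 'b" where j: "inj j" "range j \<subseteq> I"
      using I infinite_countable_subset by metis
    \<comment> \<open>The intersection of all \<open>?s (j k)\<close> is disjoint from
      \<open>c (range j)\<close>, so this sequence has empty intersection.\<close>
    let ?W = "\<lambda>n. c (range j) \<inter> (\<Inter>k\<le>n. ?s (j k))"
    have cj: "c (range j) \<in> \<U>" using j by (intro cU) (auto simp: finite_image_iff)
    have "?W n \<in> \<U>" for n
    proof (induction n)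
      case 0
      show ?case using Uint[OF cj sU[of "j 0"]] j by auto
    next
      case (Suc n)
      have "?W (Suc n) = ?W n \<inter> ?s (j (Suc n))" by (auto simp: atMost_Suc)
      then show ?case using Uint[OF Suc sU[of "j (Suc n)"]] j by (simp add: image_subset_iff)
    qed
    moreover have "decseq ?W" unfolding decseq_def by fastforce
    moreover have "(\<Inter>n. ?W n) = {}" unfolding c_def by blast
    ultimately show "\<exists>W::nat \<Rightarrow> 'a set. (\<forall>n. W n \<in> \<U>) \<and> decseq W \<and> (\<Inter>n. W n) = {}"
      by (intro exI[of _ ?W]) simp
  qed (use U in auto)
  moreover have "V \<in> \<U>" if V: "V \<subseteq> M" "\<forall>b\<in>\<U>. V \<inter> b \<noteq> {}" for V
  proof (rule ccontr)
    assume "V \<notin> \<U>"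
    then have "M - V \<in> \<U>" using Uult V by blast
    then show False using V by blast
  qed
  ultimately show ?thesis by blast
qed

lemma card_of_Pow_mono:
  assumes "|A| \<le>o |B|" shows "|Pow A| \<le>o |Pow B|"
proof -
  obtain f where f: "inj_on f A" "f ` A \<subseteq> B" using assms card_of_ordLeq by metis
  then have "inj_on ((`) f) (Pow A)" "(`) f ` Pow A \<subseteq> Pow B" by (auto simp: inj_on_image_Pow)
  then show ?thesis using card_of_ordLeq by metis
qed

lemma card_of_Pow_square:
  assumes "infinite M" shows "|Pow (M \<times> M)| \<le>o |Pow M|"
  by (intro card_of_Pow_mono ordIso_imp_ordLeq card_of_Times_same_infinite assms)

section \<open>Topologies given by filter bases\<close>

definition filter_nbhds :: "'a \<Rightarrow> 'a set set \<Rightarrow> 'a \<Rightarrow> 'a set set" where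
  "filter_nbhds p B x = (if x = p then insert p ` B else {{x}})"

text \<open>Besides \<open>p\<close>, the set \<open>K\<close> may contain points outside the set
  that carries the filter. They are isolated and in no basic neighbourhood of \<open>p\<close>; they
  bring the space to size \<open>\<kappa>\<close> while the filter lives on a set of size at most
  \<open>\<mu>\<close>.\<close>

abbreviation filter_space :: "'a set \<Rightarrow> 'a \<Rightarrow> 'a set set \<Rightarrow> 'a topology" where
  "filter_space K p B \<equiv> nbhd_topology K (filter_nbhds p B)"

lemma coding_baseD:
  assumes "coding_base M I A S B"
  shows "b \<in> B \<Longrightarrow> b \<subseteq> M" and "b \<in> B \<Longrightarrow> b \<noteq> {}"
    and "b \<in> B \<Longrightarrow> c \<in> B \<Longrightarrow> \<exists>e\<in>B. e \<subseteq> b \<inter> c"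
    and "i \<in> I \<Longrightarrow> \<exists>b\<in>B. b \<subseteq> signed M A S i"
  using assms unfolding coding_base_def by (blast, metis, simp, simp)

lemma nbhd_tree_filter:
  assumes cb: "coding_base M I A S B" and K: "p \<in> K" "M \<subseteq> K - {p}"
  shows "nbhd_tree K (filter_nbhds p B) (\<lambda>x. if x = p then 0 else 1)"
proof
  have BM: "b \<subseteq> M" if "b \<in> B" for b using cb that unfolding coding_base_def by blast
  fix x y V V'
  assume x: "x \<in> K" and V: "V \<in> filter_nbhds p B x"
  show "x \<in> V \<and> V \<subseteq> K" using x V BM K by (fastforce simp: filter_nbhds_def split: if_splits)
  show "(if x = p then 0 else 1) < (if y = p then 0 else (1::nat))" if "y \<in> V" "y \<noteq> x"
    using x V that by (auto simp: filter_nbhds_def split: if_splits)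
  show "V' \<subseteq> V" if "y \<in> V" "y \<noteq> x" "V' \<in> filter_nbhds p B y"
    using x V that by (auto simp: filter_nbhds_def split: if_splits)
  show "y \<in> V \<or> x \<in> V'" if "y \<in> K" "V' \<in> filter_nbhds p B y" "V \<inter> V' \<noteq> {}"
    using x V that by (auto simp: filter_nbhds_def split: if_splits)
  show "\<exists>W\<in>filter_nbhds p B x. W \<subseteq> V \<inter> V'" if V': "V' \<in> filter_nbhds p B x"
  proof (cases "x = p")
    case True
    then obtain b c where bc: "b \<in> B" "c \<in> B" "V = insert p b" "V' = insert p c"
      using V V' by (auto simp: filter_nbhds_def)
    then obtain e where "e \<in> B" "e \<subseteq> b \<inter> c" using cb unfolding coding_base_def by meson
    then show ?thesis using True bc by (auto simp: filter_nbhds_def)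
  qed (use V V' in \<open>auto simp: filter_nbhds_def\<close>)
next
  fix x assume x: "x \<in> K"
  show "\<exists>W::nat \<Rightarrow> 'a set. (\<forall>n. W n \<in> filter_nbhds p B x) \<and> decseq W \<and> (\<Inter>n. W n) = {x}"
  proof (cases "x = p")
    case True
    obtain W :: "nat \<Rightarrow> 'a set" where W: "\<And>n. W n \<in> B" "decseq W" "(\<Inter>n. W n) = {}"
      using cb unfolding coding_base_def by blast
    have "decseq (\<lambda>n. insert p (W n))" using W(2) unfolding decseq_def by blast
    moreover have "(\<Inter>n. insert p (W n)) = {x}" using W(3) True by blast
    ultimately show ?thesis using W(1) True
      by (intro exI[of _ "\<lambda>n. insert p (W n)"]) (auto simp: filter_nbhds_def)
  qed (intro exI[of _ "\<lambda>n. {x}"], auto simp: filter_nbhds_def)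
next
  fix C :: "'a set" assume C: "C \<subseteq> K" "C \<noteq> {}"
  show "\<exists>x\<in>C. \<exists>V\<in>filter_nbhds p B x. V \<inter> C = {x}"
  proof (cases "C = {p}")
    case True
    moreover obtain b where "b \<in> B" using cb unfolding coding_base_def by blast
    ultimately show ?thesis by (auto simp: filter_nbhds_def)
  next
    case False
    then obtain x where "x \<in> C" "x \<noteq> p" using C by blast
    then show ?thesis by (intro bexI[of _ x] bexI[of _ "{x}"]) (auto simp: filter_nbhds_def)
  qed
qed

text \<open>Stated for any tree-like space with a filter point \<open>p\<close>, so that it covers
  both the filter spaces and their sums with trees. All basic neighbourhoods together number at most
  \<open>r\<close>; the lower bound uses the sets \<open>insert p (signed M A S i)\<close>.\<close>

lemma coding_has_weight:
  assumes tree: "nbhd_tree P N d" and r: "Card_order r" "infinite (Field r)"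
    and p: "p \<in> P" "N p = insert p ` B" and M: "M \<subseteq> P - {p}" "\<And>x. x \<in> M \<Longrightarrow> {x} \<in> N x"
    and cb: "coding_base M (Field r) A S B"
    and card: "|P| \<le>o r" "\<And>x. x \<in> P \<Longrightarrow> |N x| \<le>o r"
  shows "has_weight (nbhd_topology P N) r"
proof -
  interpret nbhd_tree P N d by (rule tree)
  show ?thesis
  proof (rule has_weightI[OF r topology_base_N])
    show "|\<Union>x\<in>P. N x| \<le>o r"
      using card r by (intro UNION_Cinfinite_bound) (auto simp: cinfinite_def)
    show "openin X (insert p (signed M A S i)) \<and> p \<in> insert p (signed M A S i)" if i: "i \<in> Field r" for i
    proof -
      obtain b where b: "b \<in> B" "b \<subseteq> signed M A S i" using cb i unfolding coding_base_def by blast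
      have "insert p b \<in> N p" using b(1) p(2) by simp
      moreover have "{x} \<in> N x" if "x \<in> signed M A S i" for x
        using M(2) that by (simp add: signed_def)
      moreover have "signed M A S i \<subseteq> P" using M by (auto simp: signed_def)
      ultimately show ?thesis unfolding openin_iff using b(2) p(1) by blast
    qed
    show "finite {i\<in>Field r. U \<subseteq> insert p (signed M A S i)}" if U: "openin X U" "p \<in> U" for U
    proof -
      obtain V where "V \<in> N p" "V \<subseteq> U" using openE[OF U] by blast
      then obtain b where b: "b \<in> B" "insert p b \<subseteq> U" unfolding p(2) by blast
      then have "p \<notin> b" using cb M(1) unfolding coding_base_def by blast
      then have "{i\<in>Field r. U \<subseteq> insert p (signed M A S i)} \<subseteq> {i\<in>Field r. b \<subseteq> signed M A S i}"
        using b(2) by blast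
      then show ?thesis using cb b(1) finite_subset unfolding coding_base_def by blast
    qed
  qed
qed

section \<open>Filter spaces: closures, decoding and homeomorphisms\<close>

context
  fixes K M :: "'a set" and p :: 'a and I :: "'b set" and A :: "'b \<Rightarrow> 'a set"
  assumes K: "p \<in> K" "M \<subseteq> K - {p}"
begin

lemma openin_filter_space:
  assumes cb: "coding_base M I A S B"
  shows "openin (filter_space K p B) U \<longleftrightarrow> U \<subseteq> K \<and> (p \<in> U \<longrightarrow> (\<exists>b\<in>B. b \<subseteq> U))"
proof -
  interpret nbhd_tree K "filter_nbhds p B" "\<lambda>x. if x = p then 0 else 1"
    by (rule nbhd_tree_filter[OF cb K])
  show ?thesis unfolding openin_iff filter_nbhds_def by (auto split: if_splits)
qed

lemma topspace_filter_space:
  assumes cb: "coding_base M I A S B"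
  shows "topspace (filter_space K p B) = K"
  by (rule nbhd_tree.topspace_X[OF nbhd_tree_filter[OF cb K]])

lemma almost_discrete_filter_space:
  assumes cb: "coding_base M I A S B"
  shows "almost_discrete_space (filter_space K p B)"
proof -
  let ?X = "filter_space K p B"
  have "openin (subtopology ?X (K - {p})) {x}" if "x \<in> K - {p}" for x
  proof -
    have "openin ?X {x}" using that by (auto simp: openin_filter_space[OF cb])
    then show ?thesis unfolding openin_subtopology using that by (intro exI[of _ "{x}"]) auto
  qed
  then have "subtopology ?X (K - {p}) = discrete_topology (K - {p})"
    using discrete_topology_unique[of "K - {p}" "subtopology ?X (K - {p})"]
    by (auto simp: topspace_filter_space[OF cb])
  then show ?thesis
    unfolding almost_discrete_space_def topspace_filter_space[OF cb]
    using K(1) nbhd_tree.Hausdorff_X[OF nbhd_tree_filter[OF cb K]] by blast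
qed

text \<open>Taking the closure can only add \<open>p\<close>. If it is added, every member of
  \<open>B\<close> meets \<open>U\<close>, so \<open>U \<inter> M\<close> is itself a member by
  \<open>ult\<close> and the closure is a neighbourhood of \<open>p\<close>.\<close>

lemma extremally_disconnected_filter_space:
  assumes cb: "coding_base M I A S B"
    and ult: "\<forall>U\<subseteq>M. (\<forall>b\<in>B. U \<inter> b \<noteq> {}) \<longrightarrow> U \<in> B"
  shows "extremally_disconnected_space (filter_space K p B)"
  unfolding extremally_disconnected_space_def
proof (intro allI impI)
  let ?X = "filter_space K p B"
  fix U assume U: "openin ?X U"
  have UK: "U \<subseteq> K" using U openin_filter_space[OF cb] by simp
  have cl: "x \<in> U" if "x \<in> ?X closure_of U" "x \<noteq> p" for x
  proof -
    have "x \<in> K" using that by (auto simp: in_closure_of topspace_filter_space[OF cb])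
    then have "openin ?X {x}" using that by (simp add: openin_filter_space[OF cb])
    then show ?thesis using that unfolding in_closure_of by blast
  qed
  have sub: "U \<subseteq> ?X closure_of U"
    using UK by (intro closure_of_subset) (simp add: topspace_filter_space[OF cb])
  show "openin ?X (?X closure_of U)"
  proof (cases "p \<in> ?X closure_of U \<and> p \<notin> U")
    case True
    have "U \<inter> M \<inter> b \<noteq> {}" if b: "b \<in> B" for b
    proof -
      have bM: "b \<subseteq> M" using cb b unfolding coding_base_def by blast
      then have "openin ?X (insert p b)" using b K by (auto simp: openin_filter_space[OF cb])
      then have "\<exists>y\<in>U. y \<in> insert p b" using True unfolding in_closure_of by blast
      then show ?thesis using True bM by blast
    qed
    then have "U \<inter> M \<in> B" using ult by (metis inf_le2)
    moreover have "U \<inter> M \<subseteq> ?X closure_of U" using sub by blast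
    moreover have "?X closure_of U \<subseteq> K" using closure_of_subset_topspace[of ?X U] by (simp add: topspace_filter_space[OF cb])
    ultimately show ?thesis unfolding openin_filter_space[OF cb] by blast
  next
    case False
    then have "?X closure_of U = U" using cl sub by blast
    then show ?thesis using U by simp
  qed
qed

text \<open>The topology determines the filter but not the base, so homeomorphisms are followed
  through the generated filters.\<close>

definition generated_filter :: "'a set set \<Rightarrow> 'a set set" where
  "generated_filter B = {U \<in> Pow M. \<exists>b\<in>B. b \<subseteq> U}"

text \<open>For \<open>i \<in> I\<close> the filter contains \<open>M \<inter> A i\<close> or its
  complement in \<open>M\<close>, never both, and \<open>S\<close> decides which.\<close>

lemma decode_filter:
  assumes cb: "coding_base M I A S B" and "S \<subseteq> I"
  shows "S = {i\<in>I. M \<inter> A i \<in> generated_filter B}"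
proof -
  have "i \<in> S \<longleftrightarrow> M \<inter> A i \<in> generated_filter B" if "i \<in> I" for i
  proof -
    obtain b where b: "b \<in> B" "b \<subseteq> signed M A S i" using coding_baseD(4)[OF cb \<open>i \<in> I\<close>] by blast
    show ?thesis
    proof
      assume "i \<in> S"
      then have "b \<subseteq> M \<inter> A i" using b unfolding signed_def by blast
      then show "M \<inter> A i \<in> generated_filter B" using b unfolding generated_filter_def by blast
    next
      assume "M \<inter> A i \<in> generated_filter B"
      then obtain c where c: "c \<in> B" "c \<subseteq> M \<inter> A i" unfolding generated_filter_def by blast
      then obtain e where e: "e \<in> B" "e \<subseteq> b \<inter> c" using coding_baseD(3)[OF cb b(1)] by blast
      then have "e \<noteq> {}" using coding_baseD(2)[OF cb] by blast
      then show "i \<in> S" using b c e unfolding signed_def by blast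
    qed
  qed
  then show ?thesis using \<open>S \<subseteq> I\<close> by blast
qed

text \<open>\<open>p\<close> is the only non-isolated point. If it were mapped elsewhere,
  \<open>{p}\<close> would be open and contain a member of \<open>B\<close>, which has to be empty
  since \<open>p \<notin> M\<close>.\<close>

lemma homeomorphic_map_filter_space_point:
  assumes cb: "coding_base M I A S B" and cb': "coding_base M I A S' B'"
    and h: "homeomorphic_map (filter_space K p B) (filter_space K p B') h"
  shows "h p = p"
proof (rule ccontr)
  assume "h p \<noteq> p"
  let ?X = "filter_space K p B" and ?Y = "filter_space K p B'"
  have hK: "h ` K = K" using homeomorphic_imp_surjective_map[OF h] topspace_filter_space cb cb' by metis
  have inj: "inj_on h K" using homeomorphic_imp_injective_map[OF h] topspace_filter_space cb by metis
  have "h ` {p} \<subseteq> K" using hK K(1) by blast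
  then have "openin ?Y (h ` {p})"
    using \<open>h p \<noteq> p\<close> by (simp add: openin_filter_space[OF cb'])
  then have "openin ?X {p}"
    using homeomorphic_map_openness[OF h, of "{p}"] K(1) by (simp add: topspace_filter_space[OF cb])
  then obtain b where b: "b \<in> B" "b \<subseteq> {p}" by (auto simp: openin_filter_space[OF cb])
  then have "b = {}" using cb K unfolding coding_base_def by blast
  then show False using cb b unfolding coding_base_def by blast
qed

text \<open>Only the part of a homeomorphism that maps \<open>M\<close> into \<open>M\<close> matters for the filter; it is coded
  by a subset of \<open>M \<times> M\<close>, which is why the bound does not involve the size of \<open>K\<close>.\<close>

lemma homeomorphic_filter_transfer:
  assumes cb: "coding_base M I A S B" and cb': "coding_base M I A S' B'"
    and "filter_space K p B homeomorphic_space filter_space K p B'"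
  shows "generated_filter B' \<in> (\<lambda>R. {U \<in> Pow M. {x\<in>M. \<exists>y\<in>U. (x, y) \<in> R} \<in> generated_filter B}) ` Pow (M \<times> M)"
proof -
  let ?X = "filter_space K p B" and ?Y = "filter_space K p B'"
  obtain h where h: "homeomorphic_map ?X ?Y h"
    using assms(3) unfolding homeomorphic_space by blast
  have hK: "h ` K = K" using homeomorphic_imp_surjective_map[OF h] topspace_filter_space cb cb' by metis
  have inj: "inj_on h K" using homeomorphic_imp_injective_map[OF h] topspace_filter_space cb by metis
  have hp: "h p = p" by (rule homeomorphic_map_filter_space_point[OF cb cb' h])
  have hp': "h x = p \<longleftrightarrow> x = p" if "x \<in> K" for x using inj_onD[OF inj _ that K(1)] hp by metis
  let ?R = "{(x, y) \<in> M \<times> M. h x = y}"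
  have "U \<in> generated_filter B' \<longleftrightarrow> {x\<in>M. \<exists>y\<in>U. (x, y) \<in> ?R} \<in> generated_filter B" if U: "U \<subseteq> M" for U
  proof -
    have pU: "p \<notin> U" "U \<subseteq> K" using U K by auto
    let ?P = "{x\<in>K. h x \<in> insert p U}"
    have bM: "b \<subseteq> M" if "b \<in> B" for b using cb that unfolding coding_base_def by blast
    have bM': "b \<subseteq> M" if "b \<in> B'" for b using cb' that unfolding coding_base_def by blast
    have "U \<in> generated_filter B' \<longleftrightarrow> openin ?Y (insert p U)"
    proof -
      have "b \<subseteq> insert p U \<longleftrightarrow> b \<subseteq> U" if "b \<in> B'" for b using bM'[OF that] K(2) by blast
      then show ?thesis unfolding openin_filter_space[OF cb'] generated_filter_def using U K(1) pU by simp
    qed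
    also have "\<dots> \<longleftrightarrow> openin ?Y (h ` ?P)"
    proof -
      have "insert p U \<subseteq> h ` K" using hK pU K(1) by simp
      then have "h ` ?P = insert p U" by blast
      then show ?thesis by simp
    qed
    also have "\<dots> \<longleftrightarrow> openin ?X ?P"
      by (rule homeomorphic_map_openness[OF h]) (auto simp: topspace_filter_space[OF cb])
    also have "\<dots> \<longleftrightarrow> (\<exists>b\<in>B. b \<subseteq> ?P)"
      unfolding openin_filter_space[OF cb] using K(1) hp by blast
    also have "\<dots> \<longleftrightarrow> (\<exists>b\<in>B. b \<subseteq> {x\<in>M. h x \<in> U})"
    proof -
      have "b \<subseteq> ?P \<longleftrightarrow> b \<subseteq> {x\<in>M. h x \<in> U}" if "b \<in> B" for b
        using bM[OF that] hp' K(2) by (auto simp: subset_iff) 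
      then show ?thesis by simp
    qed
    also have "{x\<in>M. h x \<in> U} = {x\<in>M. \<exists>y\<in>U. (x, y) \<in> ?R}" using U by blast
    finally show ?thesis unfolding generated_filter_def by simp
  qed
  then have "generated_filter B' = {U \<in> Pow M. {x\<in>M. \<exists>y\<in>U. (x, y) \<in> ?R} \<in> generated_filter B}"
    by (auto simp: generated_filter_def)
  then show ?thesis by blast
qed

text \<open>Any \<open>T\<close> in the class is recovered, by \<open>decode_filter\<close>, from a
  subset of \<open>M \<times> M\<close> that transfers the filter of \<open>S\<close> to that of
  \<open>T\<close>; so an image of \<open>Pow (M \<times> M)\<close> covers the class.\<close>

lemma card_homeomorphism_class:
  assumes cb: "\<And>S. S \<subseteq> I \<Longrightarrow> coding_base M I A S (B S)" and "S \<subseteq> I"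
  shows "|{T \<in> Pow I. filter_space K p (B T) homeomorphic_space filter_space K p (B S)}| \<le>o |Pow (M \<times> M)|"
proof -
  let ?g = "\<lambda>R. {i\<in>I. M \<inter> A i \<in> {U \<in> Pow M. {x\<in>M. \<exists>y\<in>U. (x, y) \<in> R} \<in> generated_filter (B S)}}"
  have "T \<in> ?g ` Pow (M \<times> M)"
    if T: "T \<subseteq> I" "filter_space K p (B T) homeomorphic_space filter_space K p (B S)" for T
  proof -
    from homeomorphic_filter_transfer[OF cb[OF assms(2)] cb[OF T(1)] homeomorphic_space_sym[THEN iffD1, OF T(2)]]
    obtain R where R: "R \<in> Pow (M \<times> M)"
      "generated_filter (B T) = {U \<in> Pow M. {x\<in>M. \<exists>y\<in>U. (x, y) \<in> R} \<in> generated_filter (B S)}"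
      by (elim imageE)
    then have "T = ?g R" using decode_filter[OF cb[OF T(1)] T(1)] by simp
    then show ?thesis using R(1) by (rule image_eqI)
  qed
  then have "{T \<in> Pow I. filter_space K p (B T) homeomorphic_space filter_space K p (B S)}
      \<subseteq> ?g ` Pow (M \<times> M)" by blast
  then show ?thesis by (rule surj_imp_ordLeq)
qed

end

section \<open>Counting homeomorphism types\<close>

lemma many_homeomorphism_types:
  fixes X :: "'i \<Rightarrow> 'a topology"
  assumes small: "\<And>S. S \<in> J \<Longrightarrow> |{T\<in>J. X T homeomorphic_space X S}| \<le>o |Q|"
    and Q: "infinite Q" "|Q| <o |J|"
  shows "\<exists>\<F>\<subseteq>X ` J. |\<F>| =o |J| \<and> pairwise (\<lambda>X Y. \<not> X homeomorphic_space Y) \<F>"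
proof -
  define rep where "rep S = (SOME T. T \<in> J \<and> X T homeomorphic_space X S)" for S
  have rep: "rep S \<in> J" "X (rep S) homeomorphic_space X S" if "S \<in> J" for S
    using someI[of "\<lambda>T. T \<in> J \<and> X T homeomorphic_space X S" S] that homeomorphic_space_refl
    unfolding rep_def by blast+
  \<comment> \<open>Homeomorphic spaces satisfy the same defining predicate, so \<open>SOME\<close>
    returns the same index for both.\<close>
  have rep_eq: "rep S = rep T" if "X S homeomorphic_space X T" for S T
  proof -
    have "(\<lambda>U. U \<in> J \<and> X U homeomorphic_space X S) = (\<lambda>U. U \<in> J \<and> X U homeomorphic_space X T)"
      using that homeomorphic_space_trans homeomorphic_space_sym by metis
    then show ?thesis by (simp add: rep_def)
  qed
  define \<F> where "\<F> = X ` rep ` J"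
  have "|\<F>| \<le>o |J|" unfolding \<F>_def image_image by (rule card_of_image)
  moreover have "|J| \<le>o |\<F>|"
  proof -
    have J: "J = (\<Union>Y\<in>\<F>. {S\<in>J. X S homeomorphic_space Y})"
      using rep homeomorphic_space_sym unfolding \<F>_def by blast
    have cls: "|{S\<in>J. X S homeomorphic_space Y}| \<le>o |Q|" if "Y \<in> \<F>" for Y
      using that small rep(1) unfolding \<F>_def by blast
    \<comment> \<open>At most \<open>|Q|\<close> classes of size at most \<open>|Q|\<close> could
      not exhaust \<open>J\<close>. So there are more than \<open>|Q|\<close> classes, and the same
      union bound, now with \<open>|\<F>|\<close>, gives \<open>|J| \<le>o |\<F>|\<close>.\<close>
    have "\<not> |\<F>| \<le>o |Q|"
    proof
      assume "|\<F>| \<le>o |Q|"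
      then have "|\<Union>Y\<in>\<F>. {S\<in>J. X S homeomorphic_space Y}| \<le>o |Q|"
        using cls by (intro card_of_UNION_ordLeq_infinite[OF Q(1)]) auto
      then have "|J| \<le>o |Q|" using J by simp
      then show False using Q(2) not_ordLeq_ordLess by blast
    qed
    then have QF: "|Q| \<le>o |\<F>|" using ordLeq_total[OF card_of_Well_order card_of_Well_order] by blast
    then have inf: "infinite \<F>" using Q(1) card_of_ordLeq_finite by blast
    have "|\<Union>Y\<in>\<F>. {S\<in>J. X S homeomorphic_space Y}| \<le>o |\<F>|"
      using cls QF ordLeq_transitive
      by (intro card_of_UNION_ordLeq_infinite[OF inf card_of_mono1[OF subset_refl]]) blast
    then show ?thesis using J by simp
  qed
  moreover have "pairwise (\<lambda>X Y. \<not> X homeomorphic_space Y) \<F>"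
  proof (rule pairwiseI)
    fix Y Z assume "Y \<in> \<F>" "Z \<in> \<F>" "Y \<noteq> Z"
    then obtain S T where ST: "S \<in> J" "T \<in> J" "Y = X (rep S)" "Z = X (rep T)" unfolding \<F>_def by blast
    show "\<not> Y homeomorphic_space Z"
    proof
      assume "Y homeomorphic_space Z"
      then have "X S homeomorphic_space X T"
        using ST rep homeomorphic_space_trans homeomorphic_space_sym by metis
      then show False using rep_eq ST \<open>Y \<noteq> Z\<close> by metis
    qed
  qed
  moreover have "\<F> \<subseteq> X ` J" using rep unfolding \<F>_def by blast
  ultimately show ?thesis using ordIso_iff_ordLeq by blast
qed

text \<open>The last clause hands the set \<open>S\<close> back, so that further properties of
  \<open>B S\<close>, such as being an ultrafilter, can be used for the members of the
  family.\<close>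

lemma almost_discrete_family:
  fixes K M :: "'a set" and r :: "'b rel"
  assumes r: "Card_order r" "infinite (Field r)" and M: "infinite M" "p \<in> K" "M \<subseteq> K - {p}" and Kr: "|K| \<le>o r"
    and base: "\<And>S. S \<subseteq> Field r \<Longrightarrow> coding_base M (Field r) A S (B S) \<and> |B S| \<le>o r"
    and small: "|Pow M| <o |Pow (Field r)|"
  shows "\<exists>\<F>. |\<F>| =o ctwo ^c r \<and> pairwise (\<lambda>X Y. \<not> X homeomorphic_space Y) \<F> \<and>
    (\<forall>X\<in>\<F>. topspace X = K \<and> has_weight X r \<and> scattered_space X \<and> strongly_zero_dimensional_space X \<and>
      hereditarily_paracompact_space X \<and> perfectly_normal_space X \<and> almost_discrete_space X \<and>
      (\<exists>S\<subseteq>Field r. X = filter_space K p (B S)))"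
proof -
  let ?X = "\<lambda>S. filter_space K p (B S)"
  have cb: "coding_base M (Field r) A S (B S)" if "S \<subseteq> Field r" for S using base that by blast
  have "|Pow (M \<times> M)| <o |Pow (Field r)|"
    using card_of_Pow_square[OF M(1)] small by (rule ordLeq_ordLess_trans)
  moreover have "infinite (Pow (M \<times> M))" using M(1) by (auto simp: finite_cartesian_product_iff)
  moreover have "|{T \<in> Pow (Field r). ?X T homeomorphic_space ?X S}| \<le>o |Pow (M \<times> M)|"
    if "S \<in> Pow (Field r)" for S
    using card_homeomorphism_class[OF M(2,3) cb] that by simp
  ultimately obtain \<F> where \<F>: "\<F> \<subseteq> ?X ` Pow (Field r)" "|\<F>| =o |Pow (Field r)|"
    "pairwise (\<lambda>X Y. \<not> X homeomorphic_space Y) \<F>"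
    using many_homeomorphism_types[of "Pow (Field r)" ?X "Pow (M \<times> M)"] by blast
  have "topspace X = K \<and> has_weight X r \<and> scattered_space X \<and> strongly_zero_dimensional_space X \<and>
      hereditarily_paracompact_space X \<and> perfectly_normal_space X \<and> almost_discrete_space X \<and>
      (\<exists>S\<subseteq>Field r. X = ?X S)" if X: "X \<in> \<F>" for X
  proof -
    have "X \<in> ?X ` Pow (Field r)" using \<F>(1) X by (rule subsetD)
    then obtain S where S: "S \<subseteq> Field r" "X = ?X S" by blast
    have ex: "\<exists>S'\<subseteq>Field r. ?X S = ?X S'" using S(1) by blast
    interpret nbhd_tree K "filter_nbhds p (B S)" "\<lambda>x. if x = p then 0 else 1"
      by (rule nbhd_tree_filter[OF cb[OF S(1)] M(2,3)])
    have "|filter_nbhds p (B S) x| \<le>o r" if "x \<in> K" for x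
    proof (cases "x = p")
      case True
      have "|insert p ` B S| \<le>o r"
        by (rule ordLeq_transitive[OF card_of_image conjunct2[OF base[OF S(1)]]])
      then show ?thesis using True by (simp add: filter_nbhds_def)
    next
      case False
      have "|{{x}}| \<le>o |Field r|" using r(2) by (intro finite_ordLeq_infinite) auto
      from ordLeq_ordIso_trans[OF this card_of_Field_ordIso[OF r(1)]]
      show ?thesis using False by (simp add: filter_nbhds_def)
    qed
    then have "has_weight (?X S) r" using M
      by (intro coding_has_weight[OF nbhd_tree_axioms r _ _ _ _ cb[OF S(1)] Kr])
        (auto simp: filter_nbhds_def)
    then show ?thesis
      using scattered_X strongly_zero_dimensional_X hereditarily_paracompact_X perfectly_normal_X
        topspace_X almost_discrete_filter_space[OF M(2,3) cb[OF S(1)]] ex unfolding S(2) by simp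
  qed
  moreover have "|\<F>| =o ctwo ^c r"
    using \<F>(2) ordIso_symmetric[OF ctwo_cexp_Pow] by (rule ordIso_transitive)
  ultimately show ?thesis using \<F>(3) by blast
qed

text \<open>\<open>M\<close> has to fit into \<open>K\<close> and be no larger than
  \<open>N\<close>, so that homeomorphism classes stay small. If \<open>N\<close> embeds into
  \<open>K - {p}\<close>, its image will do; otherwise \<open>K - {p}\<close> is the smaller set and
  is taken whole.\<close>

lemma small_subset_exists:
  fixes K :: "'a set" and N :: "'c set" and r :: "'b rel"
  assumes "infinite K" "infinite N" "r \<le>o |Pow K|" "r \<le>o |Pow N|"
  obtains p M where "p \<in> K" "M \<subseteq> K - {p}" "infinite M" "|M| \<le>o |N|" "r \<le>o |Pow M|"
proof -
  obtain p where p: "p \<in> K" using assms(1) by (metis finite.emptyI ex_in_conv)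
  show ?thesis
  proof (cases "|N| \<le>o |K - {p}|")
    case True
    then obtain f where f: "inj_on f N" "f ` N \<subseteq> K - {p}" using card_of_ordLeq by metis
    have fN: "|N| =o |f ` N|" using f(1) card_of_ordIsoI[of f N "f ` N"] by (simp add: inj_on_imp_bij_betw)
    show ?thesis
    proof (rule that[OF p f(2)])
      show "infinite (f ` N)" using assms(2) f(1) by (simp add: finite_image_iff)
      show "|f ` N| \<le>o |N|" by (rule card_of_image)
      show "r \<le>o |Pow (f ` N)|"
        using assms(4) card_of_Pow_mono[OF ordIso_imp_ordLeq[OF fN]] by (rule ordLeq_transitive)
    qed
  next
    case False
    obtain h where "bij_betw h K (K - {p})" using infinite_imp_bij_betw[OF assms(1)] by blast
    then have "|K| \<le>o |K - {p}|" using card_of_ordIsoI ordIso_imp_ordLeq by blast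
    then have "r \<le>o |Pow (K - {p})|"
      using assms(3) card_of_Pow_mono ordLeq_transitive by blast
    moreover have "|K - {p}| \<le>o |N|" using False ordLeq_total[OF card_of_Well_order card_of_Well_order] by blast
    ultimately show ?thesis using that[OF p subset_refl] assms(1) by simp
  qed
qed

lemma almost_discrete_family_exists:
  fixes K :: "'a set" and N :: "'c set" and r :: "'b rel"
  assumes r: "Card_order r" "infinite (Field r)" and K: "infinite K" "|K| \<le>o r" "r \<le>o |Pow K|"
    and N: "infinite N" "r \<le>o |Pow N|" "|Pow N| <o |Pow (Field r)|"
  shows "\<exists>\<F> :: 'a topology set. |\<F>| =o ctwo ^c r \<and> pairwise (\<lambda>X Y. \<not> X homeomorphic_space Y) \<F> \<and>
    (\<forall>X\<in>\<F>. topspace X = K \<and> has_weight X r \<and> scattered_space X \<and> strongly_zero_dimensional_space X \<and>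
      hereditarily_paracompact_space X \<and> perfectly_normal_space X \<and> almost_discrete_space X)"
proof -
  obtain p M where pM: "p \<in> K" "M \<subseteq> K - {p}" "infinite M" "|M| \<le>o |N|" "r \<le>o |Pow M|"
    using small_subset_exists[OF K(1) N(1) K(3) N(2)] by metis
  have Fr: "|Field r| =o r" by (rule card_of_Field_ordIso[OF r(1)])
  obtain A :: "'b \<Rightarrow> 'a set" where A: "independent_on M (Field r) A"
    using independent_family[OF pM(3) ordIso_ordLeq_trans[OF Fr pM(5)]] unfolding independent_on_def by metis
  have "\<exists>B. coding_base M (Field r) A S B \<and> |B| \<le>o r" for S
    using coding_base_exists[OF A r(2), of S] ordLeq_ordIso_trans[OF _ Fr] by blast
  then obtain B where "\<And>S. coding_base M (Field r) A S (B S) \<and> |B S| \<le>o r" by metis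
  moreover have "|Pow M| <o |Pow (Field r)|"
    using card_of_Pow_mono[OF pM(4)] N(3) by (rule ordLeq_ordLess_trans)
  ultimately show ?thesis
    using almost_discrete_family[OF r pM(3,1,2) K(2), of A B] by meson
qed

text \<open>The base is now a whole ultrafilter, with up to \<open>2^|M|\<close> members;
  \<open>r =o |Pow N|\<close> keeps this within \<open>r\<close>. The strict inequality between
  \<open>2^|M|\<close> and \<open>2^r\<close> then follows from Cantor's theorem for
  \<open>r\<close>.\<close>

lemma extremally_disconnected_family_exists:
  fixes K :: "'a set" and N :: "'c set" and r :: "'b rel"
  assumes r: "Card_order r" "infinite (Field r)" and K: "infinite K" "|K| \<le>o r" "r \<le>o |Pow K|"
    and N: "infinite N" "r =o |Pow N|"
  shows "\<exists>\<F> :: 'a topology set. |\<F>| =o ctwo ^c r \<and> pairwise (\<lambda>X Y. \<not> X homeomorphic_space Y) \<F> \<and>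
    (\<forall>X\<in>\<F>. topspace X = K \<and> has_weight X r \<and> scattered_space X \<and> strongly_zero_dimensional_space X \<and>
      hereditarily_paracompact_space X \<and> perfectly_normal_space X \<and> almost_discrete_space X \<and>
      extremally_disconnected_space X)"
proof -
  obtain p M where pM: "p \<in> K" "M \<subseteq> K - {p}" "infinite M" "|M| \<le>o |N|" "r \<le>o |Pow M|"
    using small_subset_exists[OF K(1) N(1) K(3) ordIso_imp_ordLeq[OF N(2)]] by metis
  have Fr: "|Field r| =o r" by (rule card_of_Field_ordIso[OF r(1)])
  obtain A :: "'b \<Rightarrow> 'a set" where A: "independent_on M (Field r) A"
    using independent_family[OF pM(3) ordIso_ordLeq_trans[OF Fr pM(5)]] unfolding independent_on_def by metis
  have PM: "|Pow M| \<le>o r"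
    using card_of_Pow_mono[OF pM(4)] ordIso_symmetric[OF N(2)] by (rule ordLeq_ordIso_trans)
  obtain B where B: "\<And>S. coding_base M (Field r) A S (B S) \<and> (\<forall>U\<subseteq>M. (\<forall>b\<in>B S. U \<inter> b \<noteq> {}) \<longrightarrow> U \<in> B S)"
    using coding_ultrafilter_exists[OF A r(2)] by metis
  have "B S \<subseteq> Pow M" for S using B[of S] unfolding coding_base_def by blast
  then have "|B S| \<le>o r" for S using ordLeq_transitive[OF card_of_mono1 PM] by blast
  moreover have "|Pow M| <o |Pow (Field r)|"
    using PM ordIso_ordLess_trans[OF ordIso_symmetric[OF Fr] card_of_Pow] by (rule ordLeq_ordLess_trans)
  ultimately obtain \<F> where \<F>: "|\<F>| =o ctwo ^c r" "pairwise (\<lambda>X Y. \<not> X homeomorphic_space Y) \<F>"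
    "\<forall>X\<in>\<F>. topspace X = K \<and> has_weight X r \<and> scattered_space X \<and> strongly_zero_dimensional_space X \<and>
      hereditarily_paracompact_space X \<and> perfectly_normal_space X \<and> almost_discrete_space X \<and>
      (\<exists>S\<subseteq>Field r. X = filter_space K p (B S))"
    using almost_discrete_family[OF r pM(3,1,2) K(2), of A B] B by meson
  have "extremally_disconnected_space X" if X: "X \<in> \<F>" for X
  proof -
    obtain S where "X = filter_space K p (B S)" using \<F>(3) X by meson
    then show ?thesis using extremally_disconnected_filter_space[OF pM(1,2)] B by blast
  qed
  then show ?thesis using \<F> by (intro exI[of _ \<F>]) simp
qed

section \<open>Exact Cantor-Bendixson rank\<close>

text \<open>The Cantor-Bendixson derivative of \<open>X\<close> at stage \<open>i\<close>, with
  stages taken from a strict well-order \<open>lt\<close> in place of ordinals: the whole space at a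
  minimal stage, otherwise the common accumulation points of all earlier stages.\<close>

inductive derived :: "'a topology \<Rightarrow> ('i \<times> 'i) set \<Rightarrow> 'i \<Rightarrow> 'a \<Rightarrow> bool" for X lt where
  "x \<in> topspace X \<Longrightarrow>
   (\<And>j U. (j, i) \<in> lt \<Longrightarrow> openin X U \<Longrightarrow> x \<in> U \<Longrightarrow> \<exists>y. y \<in> U \<and> y \<noteq> x \<and> derived X lt j y) \<Longrightarrow>
   derived X lt i x"

text \<open>The isolated points of stage \<open>i\<close>, that is, the points of Cantor-Bendixson
  rank \<open>i\<close>.\<close>

definition exact_rank :: "'a topology \<Rightarrow> ('i \<times> 'i) set \<Rightarrow> 'i \<Rightarrow> 'a \<Rightarrow> bool" where
  "exact_rank X lt i x \<longleftrightarrow> derived X lt i x \<and>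
     (\<exists>U. openin X U \<and> x \<in> U \<and> (\<forall>y\<in>U. derived X lt i y \<longrightarrow> y = x))"

text \<open>The points of exact rank \<open>i\<close> in \<open>U\<close> form an infinite set
  converging to \<open>x\<close>. For fixed \<open>lt\<close> and \<open>i\<close> this is purely
  topological, hence a homeomorphism invariant.\<close>

definition rank_limit :: "'a topology \<Rightarrow> ('i \<times> 'i) set \<Rightarrow> 'i \<Rightarrow> bool" where
  "rank_limit X lt i \<longleftrightarrow> (\<exists>x U. openin X U \<and> x \<in> U \<and> infinite {y\<in>U. exact_rank X lt i y} \<and>
     (\<forall>V. openin X V \<longrightarrow> x \<in> V \<longrightarrow> finite {y\<in>U - V. exact_rank X lt i y}))"

lemma derived_homeomorphic:
  assumes "derived X lt i x" and h: "homeomorphic_map X Y h"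
  shows "derived Y lt i (h x)"
  using assms(1)
proof induction
  case (1 x i)
  have surj: "h ` topspace X = topspace Y" and inj: "inj_on h (topspace X)"
    using h homeomorphic_imp_surjective_map homeomorphic_imp_injective_map by blast+
  show ?case
  proof (rule derived.intros)
    show "h x \<in> topspace Y" using 1 surj by blast
    fix j U assume j: "(j, i) \<in> lt" and U: "openin Y U" "h x \<in> U"
    have "openin X {z\<in>topspace X. h z \<in> U}"
      using U(1) homeomorphic_imp_continuous_map[OF h] openin_continuous_map_preimage by blast
    then obtain y where "y \<in> {z\<in>topspace X. h z \<in> U}" "y \<noteq> x" "derived Y lt j (h y)"
      using 1(2)[OF j, of "{z\<in>topspace X. h z \<in> U}"] U(2) 1(1) by auto
    then show "\<exists>y. y \<in> U \<and> y \<noteq> h x \<and> derived Y lt j y"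
      using inj_onD[OF inj, of y x] 1(1) by (intro exI[of _ "h y"]) auto
  qed
qed

lemma derived_topspace: "derived X lt i x \<Longrightarrow> x \<in> topspace X"
  by (auto elim: derived.cases)

lemma exact_rank_homeomorphic_imp:
  assumes h: "homeomorphic_maps X Y h h'" and x: "exact_rank X lt i x"
  shows "exact_rank Y lt i (h x)"
proof -
  have hm: "homeomorphic_map X Y h" "homeomorphic_map Y X h'"
    using h homeomorphic_maps_map by blast+
  obtain U where U: "openin X U" "x \<in> U" "\<forall>y\<in>U. derived X lt i y \<longrightarrow> y = x"
    and d: "derived X lt i x" using x unfolding exact_rank_def by blast
  have UX: "U \<subseteq> topspace X" using U(1) by (rule openin_subset)
  have "openin Y (h ` U)" using homeomorphic_map_openness[OF hm(1) UX] U(1) by simp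
  moreover have "y = h x" if y: "y \<in> h ` U" "derived Y lt i y" for y
  proof -
    obtain u where u: "u \<in> U" "y = h u" using y(1) by blast
    have "h' y = u" using h u UX unfolding homeomorphic_maps_def by auto
    then have "derived X lt i u" using derived_homeomorphic[OF y(2) hm(2)] by simp
    then show ?thesis using U(3) u by blast
  qed
  ultimately show ?thesis
    unfolding exact_rank_def using derived_homeomorphic[OF d hm(1)] U(2) by blast
qed

lemma rank_limit_homeomorphic:
  assumes "X homeomorphic_space Y" and "rank_limit X lt i"
  shows "rank_limit Y lt i"
proof -
  obtain h h' where h: "homeomorphic_maps X Y h h'" using assms(1) unfolding homeomorphic_space_def by blast
  then have hm: "homeomorphic_map X Y h" using homeomorphic_maps_map by blast
  have h': "homeomorphic_maps Y X h' h" using h homeomorphic_maps_sym by blast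
  have inv: "h' (h x) = x" if "x \<in> topspace X" for x using h that unfolding homeomorphic_maps_def by auto
  obtain x U where U: "openin X U" "x \<in> U" "infinite {y\<in>U. exact_rank X lt i y}"
    and fin: "\<And>V. openin X V \<Longrightarrow> x \<in> V \<Longrightarrow> finite {y\<in>U - V. exact_rank X lt i y}"
    using assms(2) unfolding rank_limit_def by blast
  have UX: "U \<subseteq> topspace X" using U(1) by (rule openin_subset)
  have inj: "inj_on h U" using homeomorphic_imp_injective_map[OF hm] UX inj_on_subset by blast
  have rank: "exact_rank Y lt i (h y) \<longleftrightarrow> exact_rank X lt i y" if "y \<in> U" for y
  proof -
    have "y \<in> topspace X" using that UX by blast
    then show ?thesis
      using exact_rank_homeomorphic_imp[OF h, of lt i y] exact_rank_homeomorphic_imp[OF h', of lt i "h y"]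
      by (auto simp: inv)
  qed
  show ?thesis
    unfolding rank_limit_def
  proof (intro exI conjI allI impI)
    show "openin Y (h ` U)" using homeomorphic_map_openness[OF hm UX] U(1) by simp
    show "h x \<in> h ` U" using U(2) by blast
    have "{y \<in> h ` U. exact_rank Y lt i y} = h ` {y\<in>U. exact_rank X lt i y}" using rank by blast
    moreover have "inj_on h {y\<in>U. exact_rank X lt i y}" using inj by (rule inj_on_subset) blast
    ultimately show "infinite {y \<in> h ` U. exact_rank Y lt i y}"
      using U(3) finite_imageD by metis
    fix V assume V: "openin Y V" "h x \<in> V"
    let ?V = "{z\<in>topspace X. h z \<in> V}"
    have "openin X ?V"
      using V(1) homeomorphic_imp_continuous_map[OF hm] openin_continuous_map_preimage by blast
    then have "finite (h ` {y\<in>U - ?V. exact_rank X lt i y})"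
      using fin[of ?V] V(2) U(2) UX by blast
    moreover have "{y \<in> h ` U - V. exact_rank Y lt i y} \<subseteq> h ` {y\<in>U - ?V. exact_rank X lt i y}"
      using rank UX by blast
    ultimately show "finite {y \<in> h ` U - V. exact_rank Y lt i y}" by (rule finite_subset[rotated])
  qed
qed

text \<open>Basic neighbourhoods suffice for testing accumulation, and as an equivalence this can be
  unfolded for each stage separately.\<close>

lemma (in nbhd_tree) derived_iff:
  "derived X lt i x \<longleftrightarrow> x \<in> P \<and> (\<forall>j V. (j, i) \<in> lt \<longrightarrow> V \<in> N x \<longrightarrow> (\<exists>y\<in>V. y \<noteq> x \<and> derived X lt j y))"
proof
  assume d: "derived X lt i x"
  then have x: "x \<in> P" using derived_topspace by fastforce
  have "\<exists>y\<in>V. y \<noteq> x \<and> derived X lt j y" if "(j, i) \<in> lt" "V \<in> N x" for j V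
  proof -
    have "openin X V" "x \<in> V" using N_open N_mem x that(2) by auto
    with d show ?thesis using that(1) by cases blast
  qed
  then show "x \<in> P \<and> (\<forall>j V. (j, i) \<in> lt \<longrightarrow> V \<in> N x \<longrightarrow> (\<exists>y\<in>V. y \<noteq> x \<and> derived X lt j y))"
    using x by blast
next
  assume R: "x \<in> P \<and> (\<forall>j V. (j, i) \<in> lt \<longrightarrow> V \<in> N x \<longrightarrow> (\<exists>y\<in>V. y \<noteq> x \<and> derived X lt j y))"
  show "derived X lt i x"
  proof (rule derived.intros)
    show "x \<in> topspace X" using R by simp
    fix j U assume "(j, i) \<in> lt" "openin X U" "x \<in> U"
    moreover from this obtain V where "V \<in> N x" "V \<subseteq> U" using openE by blast
    ultimately show "\<exists>y. y \<in> U \<and> y \<noteq> x \<and> derived X lt j y" using R by (meson subsetD)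
  qed
qed

section \<open>Trees with prescribed rank limits\<close>

text \<open>Lists grow at the front: \<open>u @ c # s\<close> is a descendant of \<open>s\<close>,
  and \<open>c\<close> is the entry of the child of \<open>s\<close> through which it is reached. A
  cone with parameter \<open>m\<close> thus drops the entire subtrees of the children on levels
  below \<open>m\<close>.\<close>

definition level_cone :: "('c \<times> nat \<times> 'd) list set \<Rightarrow> ('c \<times> nat \<times> 'd) list \<Rightarrow> nat \<Rightarrow> ('c \<times> nat \<times> 'd) list set" where
  "level_cone T s m = insert s {t \<in> T. \<exists>u c. t = u @ c # s \<and> m \<le> fst (snd c)}"

text \<open>Centres of intersecting cones lie on one branch, which gives \<open>N_meet\<close>. A
  descendant leaves the cones of \<open>s\<close> once the parameter exceeds the level of the child
  it sits above, which gives \<open>N_seq\<close>; \<open>wf\<close> gives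
  \<open>N_scat\<close>.\<close>

lemma nbhd_tree_cone:
  assumes wf: "\<And>A. A \<subseteq> T \<Longrightarrow> A \<noteq> {} \<Longrightarrow> \<exists>s\<in>A. \<forall>u c. u @ c # s \<notin> A"
  shows "nbhd_tree T (\<lambda>s. range (level_cone T s)) length"
proof
  fix s V t V'
  assume s: "s \<in> T" and "V \<in> range (level_cone T s)"
  then obtain m where m: "V = level_cone T s m" by blast
  show "s \<in> V \<and> V \<subseteq> T" using s m by (auto simp: level_cone_def)
  show "length s < length t" if "t \<in> V" "t \<noteq> s" using that m by (auto simp: level_cone_def)
  show "V' \<subseteq> V" if "t \<in> V" "t \<noteq> s" "V' \<in> range (level_cone T t)"
  proof -
    obtain m' where m': "V' = level_cone T t m'" using \<open>V' \<in> range (level_cone T t)\<close> by blast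
    obtain u c where uc: "t = u @ c # s" "m \<le> fst (snd c)" "t \<in> T"
      using \<open>t \<in> V\<close> \<open>t \<noteq> s\<close> m by (auto simp: level_cone_def)
    have "v @ e # t \<in> V" if "v @ e # t \<in> T" for v e
    proof -
      have "v @ e # t = (v @ e # u) @ c # s" using uc by simp
      then show ?thesis using that uc(2) m unfolding level_cone_def by blast
    qed
    then show ?thesis using m' \<open>t \<in> V\<close> by (auto simp: level_cone_def)
  qed
  show "\<exists>W\<in>range (level_cone T s). W \<subseteq> V \<inter> V'" if "V' \<in> range (level_cone T s)"
  proof -
    obtain m' where m': "V' = level_cone T s m'" using \<open>V' \<in> range (level_cone T s)\<close> by blast
    have "level_cone T s (max m m') \<subseteq> V \<inter> V'" using m m' by (auto simp: level_cone_def)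
    then show ?thesis by blast
  qed
  show "t \<in> V \<or> s \<in> V'" if t: "t \<in> T" "V' \<in> range (level_cone T t)" "V \<inter> V' \<noteq> {}"
  proof -
    obtain m' where m': "V' = level_cone T t m'" using t(2) by blast
    \<comment> \<open>Both centres are suffixes of the common node \<open>z\<close>, so the shorter
      is a suffix of the longer, and the entry \<open>c\<close> next to \<open>t\<close> is the same
      whether seen from \<open>z\<close> or from \<open>s\<close>.\<close>
    have *: "s \<in> level_cone T t k"
      if "s \<in> T" "z = u @ c # t" "z = v @ s" "length t < length s" "k \<le> fst (snd c)"
      for s t z k u v and c :: "'a \<times> nat \<times> 'b"
    proof -
      from that have "u @ c # t = v @ s" by simp
      then obtain w where w: "u = v @ w \<and> w @ c # t = s \<or> u @ w = v \<and> c # t = w @ s"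
        by (auto simp: append_eq_append_conv2)
      then show ?thesis
      proof
        assume "u = v @ w \<and> w @ c # t = s"
        then show ?thesis using that unfolding level_cone_def by blast
      next
        assume a: "u @ w = v \<and> c # t = w @ s"
        then have "w = []" using that(4) by (metis length_Cons length_append add_le_same_cancel2 le_zero_eq
            length_0_conv less_eq_Suc_le)
        then have "s = [] @ c # t" using a by simp
        then show ?thesis using that unfolding level_cone_def by blast
      qed
    qed
    obtain z where z: "z \<in> V" "z \<in> V'" using t(3) by blast
    then consider "s = t" | "z = s" "s \<noteq> t" | "z = t" "s \<noteq> t" |
       (both) u c u' c' where "z = u @ c # s" "m \<le> fst (snd c)" "z = u' @ c' # t" "m' \<le> fst (snd c')"
      unfolding m m' level_cone_def by blast
    then show ?thesis
    proof cases
      case both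
      show ?thesis
      proof (rule linorder_cases[of "length s" "length t"])
        assume "length s < length t"
        then show ?thesis using *[of t z u c s "u' @ [c']" m] t both m by simp
      next
        assume "length s > length t"
        then show ?thesis using *[of s z u' c' t "u @ [c]" m'] s both m' by simp
      next
        assume "length s = length t"
        then have "s = t" using both by (metis append_Cons append_eq_append_conv append.assoc append_Nil list.inject
            length_Cons append_eq_append_conv2 append_eq_append_conv)
        then show ?thesis using m by (simp add: level_cone_def)
      qed
    qed (use m z m' in \<open>auto simp: level_cone_def\<close>)
  qed
next
  fix s assume "s \<in> T"
  have "decseq (level_cone T s)" unfolding decseq_def level_cone_def by (auto intro: order_trans)
  moreover have "(\<Inter>n. level_cone T s n) = {s}"
  proof
    show "(\<Inter>n. level_cone T s n) \<subseteq> {s}"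
    proof (rule ccontr)
      assume "\<not> ?thesis"
      then obtain t where t: "t \<noteq> s" "\<And>n. t \<in> level_cone T s n" by blast
      then have ex: "\<exists>u c. t = u @ c # s \<and> n \<le> fst (snd c)" for n unfolding level_cone_def by blast
      obtain u c where uc: "t = u @ c # s" using ex[of 0] by blast
      obtain v e where "t = v @ e # s" "Suc (fst (snd c)) \<le> fst (snd e)" using ex by blast
      then show False using uc by auto
    qed
  qed (auto simp: level_cone_def)
  ultimately show "\<exists>W::nat \<Rightarrow> ('a \<times> nat \<times> 'b) list set. (\<forall>n. W n \<in> range (level_cone T s)) \<and> decseq W \<and> (\<Inter>n. W n) = {s}"
    by (intro exI[of _ "level_cone T s"]) simp
next
  fix A assume A: "A \<subseteq> T" "A \<noteq> {}"
  then obtain s where "s \<in> A" "\<forall>u c. u @ c # s \<notin> A" using wf by blast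
  then show "\<exists>s\<in>A. \<exists>V\<in>range (level_cone T s). V \<inter> A = {s}"
    by (intro bexI[of _ s] bexI[of _ "level_cone T s 0"]) (auto simp: level_cone_def)
qed

text \<open>Nodes are lists with the root last; an entry is a label, the level used by \<open>level_cone\<close>, and a
  multiplicity. Below a root \<open>(i, 0, 0)\<close> sits one child of label \<open>i\<close> on each level, whereas all other
  nodes have infinitely many children of each smaller label on each level.\<close>

inductive_set tree_nodes :: "('a \<times> 'a) set \<Rightarrow> 'a set \<Rightarrow> ('a \<times> nat \<times> nat) list set" for lt S where
  root: "i \<in> S \<Longrightarrow> [(i, 0, 0)] \<in> tree_nodes lt S"
| stem: "i \<in> S \<Longrightarrow> [(i, n, 0), (i, 0, 0)] \<in> tree_nodes lt S"
| node: "c # e # s \<in> tree_nodes lt S \<Longrightarrow> (j, fst c) \<in> lt \<Longrightarrow> (j, n, k) # c # e # s \<in> tree_nodes lt S"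

abbreviation label :: "('a \<times> nat \<times> nat) list \<Rightarrow> 'a" where
  "label s \<equiv> fst (hd s)"

lemma tree_nodes_nonempty: "s \<in> tree_nodes lt S \<Longrightarrow> s \<noteq> []"
  by (cases rule: tree_nodes.cases) auto

lemma tree_nodes_label: "s \<in> tree_nodes lt S \<Longrightarrow> label s \<in> S \<union> Domain lt"
  by (cases rule: tree_nodes.cases) auto

lemma tree_nodes_singleton: "[c] \<in> tree_nodes lt S \<Longrightarrow> \<exists>i\<in>S. c = (i, 0, 0)"
  by (cases rule: tree_nodes.cases) auto

lemma tree_nodes_pair: "[c, e] \<in> tree_nodes lt S \<Longrightarrow> \<exists>i\<in>S. \<exists>n. c = (i, n, 0) \<and> e = (i, 0, 0)"
  by (cases rule: tree_nodes.cases) auto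

lemma tree_nodes_Cons:
  assumes "c # s \<in> tree_nodes lt S" "length s \<ge> 2"
  shows "s \<in> tree_nodes lt S" "(fst c, label s) \<in> lt"
  using assms by (cases rule: tree_nodes.cases; auto)+

lemma tree_nodes_tl:
  assumes "c # s \<in> tree_nodes lt S" "s \<noteq> []"
  shows "s \<in> tree_nodes lt S"
  using assms by (cases rule: tree_nodes.cases) (auto simp: tree_nodes.root)

lemma tree_nodes_suffix: "u @ s \<in> tree_nodes lt S \<Longrightarrow> s \<noteq> [] \<Longrightarrow> s \<in> tree_nodes lt S"
  by (induction u) (auto dest: tree_nodes_tl)

text \<open>\<open>length s \<ge> 2\<close> excludes a root, whose children repeat its label; from
  there on each step lowers the label, and \<open>trans lt\<close> chains the steps.\<close>

lemma tree_nodes_label_less: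
  assumes "trans lt" "u @ c # s \<in> tree_nodes lt S" "length s \<ge> 2"
  shows "(label (u @ c # s), label s) \<in> lt"
  using assms(2)
proof (induction u)
  case Nil
  then show ?case using tree_nodes_Cons(2)[of c s] assms(3) by simp
next
  case (Cons b u)
  have l: "length (u @ c # s) \<ge> 2" using assms(3) by simp
  have "u @ c # s \<in> tree_nodes lt S" and b: "(fst b, label (u @ c # s)) \<in> lt"
    using tree_nodes_Cons[of b "u @ c # s"] Cons.prems l by auto
  from transD[OF assms(1) b Cons.IH[OF this(1)]] show ?case by simp
qed

lemma tree_nodes_above_root:
  assumes "trans lt" "u @ c # [e] \<in> tree_nodes lt S"
  shows "\<exists>i\<in>S. \<exists>n. c = (i, n, 0) \<and> e = (i, 0, 0) \<and> (u \<noteq> [] \<longrightarrow> (label (u @ c # [e]), i) \<in> lt)"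
proof -
  have "[c, e] \<in> tree_nodes lt S" using tree_nodes_suffix[OF assms(2)] by simp
  then obtain i n where i: "i \<in> S" "c = (i, n, 0)" "e = (i, 0, 0)" using tree_nodes_pair by blast
  have "(label (u @ c # [e]), i) \<in> lt" if u: "u \<noteq> []"
  proof -
    obtain v b where "u = v @ [b]" using u by (cases u rule: rev_cases) auto
    then show ?thesis using tree_nodes_label_less[OF assms(1), of v b "[c, e]"] assms(2) i by simp
  qed
  then show ?thesis using i by blast
qed

text \<open>Among the nodes of \<open>A\<close> other than roots, one with minimal label has no
  proper descendant in \<open>A\<close>, as descendants have smaller labels. If \<open>A\<close>
  consists of roots, any element will do.\<close>

lemma tree_nodes_wf:
  assumes "wf lt" "trans lt" "A \<subseteq> tree_nodes lt S" "A \<noteq> {}"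
  shows "\<exists>s\<in>A. \<forall>u c. u @ c # s \<notin> A"
proof (cases "\<exists>s\<in>A. length s \<ge> 2")
  case True
  then obtain s0 where "label s0 \<in> label ` {s\<in>A. length s \<ge> 2}" by blast
  from wfE_min[OF assms(1) this] obtain i where i: "i \<in> label ` {s\<in>A. length s \<ge> 2}"
    "\<And>j. (j, i) \<in> lt \<Longrightarrow> j \<notin> label ` {s\<in>A. length s \<ge> 2}" by auto
  then obtain s where s: "s \<in> A" "length s \<ge> 2" "i = label s" by blast
  have "u @ c # s \<notin> A" for u c
  proof
    assume a: "u @ c # s \<in> A"
    then have "(label (u @ c # s), i) \<in> lt" using tree_nodes_label_less assms s by blast
    moreover have "length (u @ c # s) \<ge> 2" using s(2) by simp
    ultimately show False using i(2) a by blast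
  qed
  then show ?thesis using s(1) by blast
next
  case False
  obtain s where s: "s \<in> A" using assms(4) by blast
  then have "s \<noteq> []" using assms(3) tree_nodes_nonempty by blast
  then have "length (u @ c # s) \<ge> 2" for u c by (cases s) auto
  then show ?thesis using False s by blast
qed

text \<open>The sum of a part \<open>Y\<close>, isolated except perhaps at \<open>p\<close>, which
  will carry the weight, and a copy of the tree for \<open>S\<close>. \<open>Range lt\<close>
  consists of the non-minimal stages; isolated points do not reach these, so \<open>Y\<close>
  contributes at most \<open>p\<close> and cannot disturb the coding of \<open>S\<close>.\<close>

locale ranked_sum = nbhd_tree P N d
  for P :: "'p set" and N d +
  fixes Y :: "'p set" and p :: 'p and lt :: "('i \<times> 'i) set" and L S :: "'i set"
    and g :: "('i \<times> nat \<times> nat) list \<Rightarrow> 'p"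
  assumes P_def: "P = Y \<union> g ` tree_nodes lt S" and disj: "Y \<inter> g ` tree_nodes lt S = {}"
    and inj_g: "inj_on g (tree_nodes lt S)"
    and N_g: "\<And>s. s \<in> tree_nodes lt S \<Longrightarrow> N (g s) = range (\<lambda>m. g ` level_cone (tree_nodes lt S) s m)"
    and N_Y: "\<And>x V. x \<in> Y \<Longrightarrow> V \<in> N x \<Longrightarrow> V \<subseteq> Y"
    and N_isolated: "\<And>x. x \<in> Y \<Longrightarrow> x \<noteq> p \<Longrightarrow> {x} \<in> N x"
    and lt: "wf lt" "trans lt" "lt \<subseteq> L \<times> L" "total_on L lt"
    and S: "S \<subseteq> Range lt"
begin

abbreviation T where "T \<equiv> tree_nodes lt S"

abbreviation C where "C \<equiv> level_cone T"

lemma labels: "s \<in> T \<Longrightarrow> label s \<in> L"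
  using tree_nodes_label[of s lt S] S lt(3) by blast

lemma g_eq: "s \<in> T \<Longrightarrow> t \<in> T \<Longrightarrow> g s = g t \<longleftrightarrow> s = t"
  using inj_g by (auto dest: inj_onD)

lemma cone_cases:
  assumes "s \<in> T" "t \<in> C s m" "t \<noteq> s" "length s \<ge> 2"
  shows "t \<in> T" "length t \<ge> 2" "(label t, label s) \<in> lt"
  using assms tree_nodes_label_less[OF lt(2), of _ _ s S] by (auto simp: level_cone_def)

lemma cone_subset: "s \<in> T \<Longrightarrow> C s m \<subseteq> T"
  by (auto simp: level_cone_def)

lemma child_in_cone: "c # s \<in> T \<Longrightarrow> m \<le> fst (snd c) \<Longrightarrow> c # s \<in> C s m"
  unfolding level_cone_def by (metis (mono_tags, lifting) append_Nil insertCI mem_Collect_eq)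

lemma child_node:
  assumes "s \<in> T" "length s \<ge> 2" "(j, label s) \<in> lt"
  shows "(j, n, k) # s \<in> T"
proof -
  obtain c e s' where "s = c # e # s'" using assms(2)
    by (metis Suc_le_length_iff numeral_2_eq_2)
  then show ?thesis using assms tree_nodes.node by simp
qed

lemma lt_irrefl: "(i, i) \<notin> lt"
  using lt(1) by auto

lemma open_contains_cone:
  assumes "openin X U" "g s \<in> U" "s \<in> T"
  shows "\<exists>m. g ` C s m \<subseteq> U"
proof -
  obtain V where "V \<in> N (g s)" "V \<subseteq> U" using openE[OF assms(1,2)] by blast
  moreover from this have "V \<in> range (\<lambda>m. g ` C s m)" unfolding N_g[OF assms(3)] by simp
  ultimately show ?thesis by (elim imageE) auto
qed

text \<open>The rank of a node other than a root is its label: apart from \<open>s\<close>, the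
  cones of \<open>s\<close> contain only smaller labels, and every smaller label occurs among the
  children on every level.\<close>

lemma derived_node:
  assumes "i \<in> L" "s \<in> T" "length s \<ge> 2"
  shows "derived X lt i (g s) \<longleftrightarrow> i = label s \<or> (i, label s) \<in> lt"
  using lt(1) assms
proof (induction i arbitrary: s rule: wf_induct_rule)
  case (less i)
  note IH = less.IH and i = less.prems(1) and s = less.prems(2,3)
  show ?case
  proof
    assume d: "derived X lt i (g s)"
    show "i = label s \<or> (i, label s) \<in> lt"
    proof (rule ccontr)
      assume "\<not> ?thesis"
      \<comment> \<open>With the label below \<open>i\<close>, some proper descendant would be
        derived at stage \<open>label s\<close>, and by induction its label would be at least
        \<open>label s\<close>.\<close>
      then have l: "(label s, i) \<in> lt" using lt(4) i labels[OF s(1)] unfolding total_on_def by blast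
      have "g ` C s 0 \<in> N (g s)" using N_g[OF s(1)] by blast
      then obtain y where y: "y \<in> g ` C s 0" "y \<noteq> g s" "derived X lt (label s) y"
        using d l unfolding derived_iff[of lt i] by blast
      then obtain t where t: "t \<in> C s 0" "y = g t" "t \<noteq> s" by blast
      have "label s = label t \<or> (label s, label t) \<in> lt"
        using IH[OF l labels[OF s(1)] cone_cases(1,2)[OF s(1) t(1,3) s(2)]] y(3) t(2) by blast
      then show False using cone_cases(3)[OF s(1) t(1,3) s(2)] lt_irrefl transD[OF lt(2)] by metis
    qed
  next
    assume il: "i = label s \<or> (i, label s) \<in> lt"
    show "derived X lt i (g s)"
      unfolding derived_iff[of lt i]
    proof (intro conjI allI impI)
      show "g s \<in> P" using s P_def by blast
      fix j V assume j: "(j, i) \<in> lt" and "V \<in> N (g s)"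
      then obtain m where V: "V = g ` C s m" using N_g[OF s(1)] by blast
      have jl: "(j, label s) \<in> lt" using il j transD[OF lt(2)] by blast
      \<comment> \<open>Level \<open>m\<close> puts this child inside the given cone.\<close>
      let ?t = "(j, m, 0) # s"
      have t: "?t \<in> T" by (rule child_node[OF s jl])
      have "j \<in> L" using jl lt(3) by blast
      then have "derived X lt j (g ?t)" using IH[OF j _ t] s(2) by simp
      moreover have "?t \<in> C s m" using child_in_cone[OF t] by simp
      moreover have "g ?t \<noteq> g s" using g_eq[OF t s(1)] by simp
      ultimately show "\<exists>y\<in>V. y \<noteq> g s \<and> derived X lt j y" using V by blast
    qed
  qed
qed

lemma exact_rank_node:
  assumes i: "i \<in> L" and s: "s \<in> T" "length s \<ge> 2"
  shows "exact_rank X lt i (g s) \<longleftrightarrow> i = label s"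
proof
  assume r: "exact_rank X lt i (g s)"
  then obtain U where U: "openin X U" "g s \<in> U" "\<forall>y\<in>U. derived X lt i y \<longrightarrow> y = g s"
    unfolding exact_rank_def by blast
  show "i = label s"
  proof (rule ccontr)
    assume "i \<noteq> label s"
    then have il: "(i, label s) \<in> lt" using r derived_node[OF i s] unfolding exact_rank_def by blast
    obtain m where m: "g ` C s m \<subseteq> U" using open_contains_cone[OF U(1,2) s(1)] by blast
    \<comment> \<open>A child of label \<open>i\<close> inside \<open>U\<close> is derived at stage
      \<open>i\<close> too, so \<open>g s\<close> would not be isolated in that stage.\<close>
    let ?t = "(i, m, 0) # s"
    have t: "?t \<in> T" by (rule child_node[OF s il])
    have "derived X lt i (g ?t)" using derived_node[OF i t] s by simp
    moreover have "g ?t \<in> U" using child_in_cone[OF t, of m] m by auto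
    ultimately show False using U(3) g_eq[OF t s(1)] by auto
  qed
next
  assume i': "i = label s"
  have V: "g ` C s 0 \<in> N (g s)" using N_g[OF s(1)] by blast
  have gs: "g s \<in> P" using s P_def by blast
  have "y = g s" if y: "y \<in> g ` C s 0" "derived X lt i y" for y
  proof (rule ccontr)
    assume "y \<noteq> g s"
    then obtain t where t: "t \<in> C s 0" "y = g t" "t \<noteq> s" using y(1) by blast
    note tt = cone_cases[OF s(1) t(1,3) s(2)]
    have "i = label t \<or> (i, label t) \<in> lt" using derived_node[OF i tt(1,2)] y(2) t(2) by blast
    then show False using tt(3) i' lt_irrefl transD[OF lt(2)] by metis
  qed
  moreover have "openin X (g ` C s 0)" "g s \<in> g ` C s 0" using N_open[OF gs V] N_mem[OF gs V] by auto
  ultimately show "exact_rank X lt i (g s)"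
    unfolding exact_rank_def using derived_node[OF i s] i' by blast
qed

lemma not_derived_isolated:
  assumes "x \<in> Y" "x \<noteq> p" "i \<in> Range lt"
  shows "\<not> derived X lt i x"
  unfolding derived_iff[of lt i] using N_isolated[OF assms(1,2)] assms(3) by blast

lemma open_Y: "openin X Y"
  unfolding openin_iff using N_Y N_nonempty P_def by blast

text \<open>The limit is the root \<open>[(i, 0, 0)]\<close>. Among its proper descendants only the
  children have label \<open>i\<close>, one on each level, and every neighbourhood of the root
  contains all but finitely many of them.\<close>

lemma rank_limitI:
  assumes i: "i \<in> S" shows "rank_limit X lt i"
proof -
  let ?r = "[(i, 0, 0)]" and ?c = "\<lambda>n. [(i, n, 0), (i, 0, 0)]"
  have iL: "i \<in> L" using i S lt(3) by blast
  have r: "?r \<in> T" by (rule tree_nodes.root[OF i])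
  have c: "?c n \<in> T" for n by (rule tree_nodes.stem[OF i])
  have gr: "g ?r \<in> P" using r P_def by blast
  have V: "g ` C ?r m \<in> N (g ?r)" for m using N_g[OF r] by blast
  show ?thesis
    unfolding rank_limit_def
  proof (intro exI conjI allI impI)
    show "openin X (g ` C ?r 0)" by (rule N_open[OF gr V])
    show "g ?r \<in> g ` C ?r 0" by (simp add: level_cone_def)
    have "inj (\<lambda>n. g (?c n))" by (rule injI) (use g_eq[OF c c] in auto)
    then have "infinite (range (\<lambda>n. g (?c n)))" by (simp add: finite_image_iff)
    moreover have "range (\<lambda>n. g (?c n)) \<subseteq> {y \<in> g ` C ?r 0. exact_rank X lt i y}"
      using child_in_cone[OF c, of 0] exact_rank_node[OF iL c] by auto
    ultimately show "infinite {y \<in> g ` C ?r 0. exact_rank X lt i y}" by (meson finite_subset)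
    fix U assume "openin X U" "g ?r \<in> U"
    then obtain m where m: "g ` C ?r m \<subseteq> U" using open_contains_cone r by blast
    have "y \<in> (\<lambda>n. g (?c n)) ` {..<m}" if y: "y \<in> g ` C ?r 0 - U" "exact_rank X lt i y" for y
    proof -
      obtain t where t: "t \<in> C ?r 0" "y = g t" using y(1) by auto
      have "t \<noteq> ?r" using y(1) t m by (auto simp: level_cone_def)
      then obtain u b where ub: "t = u @ b # ?r" "t \<in> T" using t(1) unfolding level_cone_def by blast
      then have "\<not> m \<le> fst (snd b)" using y(1) t(2) m unfolding level_cone_def by blast
      moreover from tree_nodes_above_root[OF lt(2) ub(2)[unfolded ub(1)]]
      obtain n where n: "b = (i, n, 0)" "u \<noteq> [] \<longrightarrow> (label t, i) \<in> lt"
        unfolding ub(1) by auto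
      moreover have "label t = i" using exact_rank_node[OF iL ub(2)] ub(1) y(2) t(2) by simp
      ultimately have "u = []" "n < m" using lt_irrefl by auto
      then show ?thesis using t(2) ub(1) n(1) by (intro image_eqI[of _ _ n]) simp_all
    qed
    then have "{y \<in> g ` C ?r 0 - U. exact_rank X lt i y} \<subseteq> (\<lambda>n. g (?c n)) ` {..<m}" by blast
    then show "finite {y \<in> g ` C ?r 0 - U. exact_rank X lt i y}" by (rule finite_subset) simp
  qed
qed

text \<open>A limit must be a node \<open>s\<close> with a proper descendant of rank
  \<open>i\<close>. Unless \<open>s\<close> is the root with label \<open>i\<close>, the
  multiplicities provide infinitely many points of rank \<open>i\<close> that stay in
  \<open>U\<close> but outside a smaller cone.\<close>

lemma rank_limitD:
  assumes lim: "rank_limit X lt i" and i: "i \<in> Range lt"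
  shows "i \<in> S"
proof -
  have iL: "i \<in> L" using i lt(3) by blast
  obtain x U where U: "openin X U" "x \<in> U" "infinite {y\<in>U. exact_rank X lt i y}"
    and fin: "\<And>V. openin X V \<Longrightarrow> x \<in> V \<Longrightarrow> finite {y\<in>U - V. exact_rank X lt i y}"
    using lim unfolding rank_limit_def by blast
  have infV: "infinite {y\<in>V. exact_rank X lt i y}" if V: "openin X V" "x \<in> V" for V
  proof
    assume "finite {y\<in>V. exact_rank X lt i y}"
    moreover have "{y\<in>U. exact_rank X lt i y} \<subseteq> {y\<in>V. exact_rank X lt i y} \<union> {y\<in>U - V. exact_rank X lt i y}"
      by blast
    ultimately show False using fin[OF V] U(3) finite_subset finite_UnI by meson
  qed
  have "x \<notin> Y"
  proof
    assume "x \<in> Y"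
    then have "infinite {y\<in>Y. exact_rank X lt i y}" by (rule infV[OF open_Y])
    moreover have "{y\<in>Y. exact_rank X lt i y} \<subseteq> {p}"
      using not_derived_isolated[OF _ _ i] unfolding exact_rank_def by blast
    ultimately show False using finite_subset by blast
  qed
  moreover have "x \<in> P" using U openin_subset by fastforce
  ultimately obtain s where s: "s \<in> T" "x = g s" using P_def by blast
  have xP: "g s \<in> P" using s P_def by blast
  have V: "g ` C s m \<in> N (g s)" for m using N_g[OF s(1)] by blast
  obtain m where m: "g ` C s m \<subseteq> U" using open_contains_cone[OF U(1) _ s(1)] U(2) s(2) by blast
  have Vop: "openin X (g ` C s k)" "x \<in> g ` C s k" for k
    using N_open[OF xP V] N_mem[OF xP V[of k]] s(2) by auto
  have "infinite ({y\<in>g ` C s 0. exact_rank X lt i y} - {x})" using infV[OF Vop] by simp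
  then obtain y where "y \<in> {y\<in>g ` C s 0. exact_rank X lt i y} - {x}" by (metis ex_in_conv finite.emptyI)
  then obtain t where t: "t \<in> C s 0" "exact_rank X lt i (g t)" "t \<noteq> s" using s(2) by blast
  \<comment> \<open>For varying \<open>k\<close> the nodes \<open>(i, m', k) # w\<close> give
    infinitely many points of rank \<open>i\<close> in \<open>U\<close> outside the cone of
    \<open>s\<close> with parameter \<open>Suc m\<close>, contradicting \<open>fin\<close>.\<close>
  have impossible: False
    if w: "w \<noteq> []" "\<And>k. (i, m', k) # w \<in> T" "\<And>k. (i, m', k) # w \<in> C s m - C s (Suc m)" for w m'
  proof -
    have "g ((i, m', k) # w) \<in> U - g ` C s (Suc m)" for k
    proof -
      have "g ((i, m', k) # w) \<notin> g ` C s (Suc m)"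
        using w(3)[of k] inj_on_image_mem_iff[OF inj_g w(2) cone_subset[OF s(1), of "Suc m"]] by blast
      then show ?thesis using m w(3)[of k] by blast
    qed
    moreover have "exact_rank X lt i (g ((i, m', k) # w))" for k
      using exact_rank_node[OF iL w(2), of k] w(1) by (cases w) auto
    ultimately have "range (\<lambda>k. g ((i, m', k) # w)) \<subseteq> {y \<in> U - g ` C s (Suc m). exact_rank X lt i y}"
      unfolding image_subset_iff by simp
    moreover have "inj (\<lambda>k. g ((i, m', k) # w))" by (rule injI) (use g_eq[OF w(2) w(2)] in auto)
    then have "infinite (range (\<lambda>k. g ((i, m', k) # w)))" by (simp add: finite_image_iff)
    ultimately show False using fin[OF Vop] finite_subset by blast
  qed
  show ?thesis
  proof (cases "length s \<ge> 2")
    case True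
    note tt = cone_cases[OF s(1) t(1,3) True]
    have "label t = i" using exact_rank_node[OF iL tt(1,2)] t(2) by simp
    then have il: "(i, label s) \<in> lt" using tt(3) by simp
    have "(i, m, k) # s \<in> C s m - C s (Suc m)" for k
      using child_in_cone[OF child_node[OF s(1) True il], of m m k] by (auto simp: level_cone_def)
    then have False using impossible[of s m] child_node[OF s(1) True il] tree_nodes_nonempty[OF s(1)] by blast
    then show ?thesis ..
  next
    case False
    then obtain e where e: "s = [e]" using tree_nodes_nonempty[OF s(1)] by (cases s; cases "tl s") auto
    then obtain l where l: "l \<in> S" "e = (l, 0, 0)" using tree_nodes_singleton s(1) by blast
    obtain u b where ub: "t = u @ b # [e]" "t \<in> T" using t e unfolding level_cone_def by blast
    from tree_nodes_above_root[OF lt(2) ub(2)[unfolded ub(1)]]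
    obtain n where n: "b = (l, n, 0)" "u \<noteq> [] \<longrightarrow> (label t, l) \<in> lt"
      unfolding ub(1) l(2) by auto
    have "label t = i" using exact_rank_node[OF iL ub(2)] ub(1) t(2) by simp
    show ?thesis
    proof (cases "i = l")
      case False
      then have "(i, l) \<in> lt" using n \<open>label t = i\<close> ub(1) by (cases u) auto
      \<comment> \<open>The children of a root repeat its label \<open>l\<close>, so nodes of label
        \<open>i\<close> are taken one step further, above the child on level \<open>m\<close>. They
        drop out together with that child when the cone parameter rises to
        \<open>Suc m\<close>.\<close>
      let ?w = "(l, m, 0) # s"
      have w: "?w \<in> T" using tree_nodes.stem[OF l(1)] e l(2) by simp
      have wk: "(i, m, k) # ?w \<in> T" for k using child_node[OF w] \<open>(i, l) \<in> lt\<close> e by simp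
      have "(i, m, k) # ?w \<in> C s m" for k
        using wk[of k] unfolding level_cone_def by (auto intro!: exI[of _ "[(i, m, k)]"])
      moreover have "(i, m, k) # ?w \<notin> C s (Suc m)" for k by (auto simp: level_cone_def append_eq_Cons_conv e)
      ultimately have False using impossible[of ?w m] wk by blast
      then show ?thesis ..
    qed (use l in simp)
  qed
qed

end

section \<open>The families of spaces\<close>

text \<open>By totality, at most one element of the field, the least one, is missing from the range
  once the diagonal is removed; an infinite cardinal absorbs this.\<close>

lemma card_of_Range_order:
  assumes "Card_order k" "infinite (Field k)"
  shows "|Field k| =o |Range (k - Id)|"
proof -
  have tot: "Total k" using assms(1) unfolding card_order_on_def well_order_on_def linear_order_on_def by blast
  have sub: "Range (k - Id) \<subseteq> Field k" by (auto simp: Field_def)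
  have "|Field k| \<le>o |Range (k - Id)|"
  proof (cases "Field k \<subseteq> Range (k - Id)")
    case True
    then show ?thesis by (rule card_of_mono1)
  next
    case False
    then obtain a where a: "a \<in> Field k" "a \<notin> Range (k - Id)" by blast
    have "Field k - {a} \<subseteq> Range (k - Id)"
    proof
      fix b assume "b \<in> Field k - {a}"
      then have "(a, b) \<in> k \<or> (b, a) \<in> k" "a \<noteq> b" using tot a unfolding total_on_def by auto
      then show "b \<in> Range (k - Id)" using a(2) by blast
    qed
    moreover obtain h where "bij_betw h (Field k) (Field k - {a})"
      using infinite_imp_bij_betw[OF assms(2)] by blast
    then have "|Field k| \<le>o |Field k - {a}|" using card_of_ordIsoI ordIso_imp_ordLeq by blast
    ultimately show ?thesis using card_of_mono1 ordLeq_transitive by blast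
  qed
  then show ?thesis using card_of_mono1[OF sub] ordIso_iff_ordLeq by blast
qed

text \<open>All members share one filter space on \<open>Y\<close>, which fixes the weight, and
  differ only in the tree inside \<open>Z\<close>, whose set \<open>S\<close> is read off with
  \<open>rank_limit\<close>. Thus there are \<open>2^\<kappa>\<close> of them, whatever the value of
  \<open>2^r\<close>.\<close>

lemma scattered_family_exists:
  fixes \<kappa> :: "'a rel" and r :: "'b rel"
  assumes k: "Card_order \<kappa>" "infinite (Field \<kappa>)" and r: "Card_order r" "infinite (Field r)"
    and kr: "|Field \<kappa>| \<le>o r" "r \<le>o |Pow (Field \<kappa>)|"
  shows "\<exists>\<F> :: 'a topology set. |\<F>| =o |Pow (Field \<kappa>)| \<and> pairwise (\<lambda>X Y. \<not> X homeomorphic_space Y) \<F> \<and>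
    (\<forall>X\<in>\<F>. |topspace X| =o |Field \<kappa>| \<and> has_weight X r \<and> scattered_space X \<and>
      strongly_zero_dimensional_space X \<and> hereditarily_paracompact_space X \<and> perfectly_normal_space X)"
proof -
  define K where "K = Field \<kappa>"
  define lt where "lt = \<kappa> - Id"
  have K: "infinite K" using k(2) by (simp add: K_def)
  have wo: "trans \<kappa>" "antisym \<kappa>" "Total \<kappa>" "wf (\<kappa> - Id)"
    using k(1) unfolding card_order_on_def well_order_on_def linear_order_on_def partial_order_on_def
      preorder_on_def by auto
  have lt: "wf lt" "trans lt" "lt \<subseteq> K \<times> K" "total_on K lt"
  proof -
    show "wf lt" using wo(4) by (simp add: lt_def)
    show "trans lt" unfolding lt_def by (rule trans_diff_Id[OF wo(1,2)])
    show "lt \<subseteq> K \<times> K" unfolding lt_def K_def by (auto simp: Field_def)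
    show "total_on K lt" using wo(3) unfolding lt_def K_def total_on_def by blast
  qed
  \<comment> \<open>\<open>K\<close> contains two disjoint sets \<open>Y\<close> and
    \<open>Z\<close> of full size, the former for the filter space and the latter for the
    trees.\<close>
  have "|K <+> K| =o |K|" by (rule card_of_Plus_infinite1[OF K card_of_mono1[OF subset_refl]])
  then obtain f where f: "bij_betw f (K <+> K) K" using card_of_ordIso by blast
  have f_inj: "inj_on f (K <+> K)" and f_img: "f ` (K <+> K) = K"
    using f by (auto simp: bij_betw_def)
  define Y where "Y = f ` Inl ` K"
  define Z where "Z = f ` Inr ` K"
  have YK: "Y \<subseteq> K" "Z \<subseteq> K" using f_img by (auto simp: Y_def Z_def)
  have YZ: "Y \<inter> Z = {}" using f_inj unfolding Y_def Z_def by (auto dest: inj_onD)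
  have inj: "inj_on (\<lambda>x. f (Inl x)) K" "inj_on (\<lambda>x. f (Inr x)) K"
    using f_inj by (auto simp: inj_on_def)
  have KY: "|K| =o |Y|" "|K| =o |Z|"
    unfolding Y_def Z_def image_image
    by (rule card_of_ordIsoI[OF inj_on_imp_bij_betw[OF inj(1)]],
        rule card_of_ordIsoI[OF inj_on_imp_bij_betw[OF inj(2)]])
  have Y: "infinite Y" using KY(1) K card_of_ordIso_finite by blast
  have KKr: "|K| \<le>o r" "r \<le>o |Pow K|" using kr by (simp_all add: K_def)
  have rY: "r \<le>o |Pow Y|"
    using KKr(2) card_of_Pow_mono[OF ordIso_imp_ordLeq[OF KY(1)]] by (rule ordLeq_transitive)
  obtain p M where pM: "p \<in> Y" "M \<subseteq> Y - {p}" "infinite M" "r \<le>o |Pow M|"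
    using small_subset_exists[OF Y Y rY rY] by metis
  have Fr: "|Field r| =o r" by (rule card_of_Field_ordIso[OF r(1)])
  obtain A :: "'b \<Rightarrow> 'a set" where A: "independent_on M (Field r) A"
    using independent_family[OF pM(3) ordIso_ordLeq_trans[OF Fr pM(4)]] unfolding independent_on_def by metis
  \<comment> \<open>One filter serves all spaces; the signs \<open>{}\<close> are an arbitrary
    choice.\<close>
  obtain B where B: "coding_base M (Field r) A {} B" "|B| \<le>o |Field r|"
    using coding_base_exists[OF A r(2)] by blast
  have Br: "|B| \<le>o r" using B(2) Fr by (rule ordLeq_ordIso_trans)
  let ?E = "K \<times> (UNIV :: nat set) \<times> (UNIV :: nat set)"
  have "|UNIV :: nat set| \<le>o |K|" using K infinite_iff_card_of_nat by blast
  then have "|(UNIV :: nat set) \<times> (UNIV :: nat set)| \<le>o |K|"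
    by (intro card_of_Sigma_ordLeq_infinite[OF K]) auto
  then have EK: "|?E| \<le>o |K|"
    by (intro card_of_Sigma_ordLeq_infinite[OF K card_of_mono1[OF subset_refl]]) auto
  have "infinite ?E" using K by (auto simp add: finite_cartesian_product_iff)
  then have "|lists ?E| \<le>o |?E|" by (rule card_of_lists_ordLeq)
  from ordLeq_transitive[OF ordLeq_transitive[OF this EK] ordIso_imp_ordLeq[OF KY(2)]]
  have "|lists ?E| \<le>o |Z|" .
  \<comment> \<open>\<open>g\<close> embeds all lists of entries at once, so the same map works for
    every \<open>S\<close>.\<close>
  then obtain g where g: "inj_on g (lists ?E)" "g ` lists ?E \<subseteq> Z" using card_of_ordLeq by metis
  define T where "T S = tree_nodes lt S" for S
  define N where "N S x = (if x \<in> Y then filter_nbhds p B x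
      else (`) g ` range (level_cone (T S) (inv_into (T S) g x)))" for S x
  define P where "P S = Y \<union> g ` T S" for S
  let ?X = "\<lambda>S. nbhd_topology (P S) (N S)"
  have TE: "t \<in> lists ?E" if "S \<subseteq> Range lt" "t \<in> tree_nodes lt S" for S t
    using that(2)
  proof induction
    case (root i)
    then show ?case using that(1) lt(3) by auto
  next
    case (stem i n)
    then show ?case using that(1) lt(3) by auto
  next
    case (node c e s j n k)
    then show ?case using lt(3) by auto
  qed
  have inj_g: "inj_on g (T S)" and gZ: "g ` T S \<subseteq> Z" if "S \<subseteq> Range lt" for S
    using g TE[OF that] unfolding T_def by (auto intro: inj_on_subset)
  have disj: "Y \<inter> g ` T S = {}" if "S \<subseteq> Range lt" for S using gZ[OF that] YZ by blast
  have tree: "nbhd_tree (P S) (N S) (\<lambda>x. if x \<in> Y then (if x = p then 0 else 1) else length (inv_into (T S) g x))"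
    if "S \<subseteq> Range lt" for S
  proof -
    have "nbhd_tree (T S) (\<lambda>s. range (level_cone (T S) s)) length"
      unfolding T_def by (rule nbhd_tree_cone) (rule tree_nodes_wf[OF lt(1,2)])
    \<comment> \<open>The tree of lists is carried into \<open>K\<close> along \<open>g\<close> and
      joined to the filter space on \<open>Y\<close>; \<open>P\<close> and \<open>N\<close> are
      defined so as to match this sum literally.\<close>
    from nbhd_tree_Un[OF nbhd_tree_filter[OF B(1) pM(1,2)] nbhd_tree_image[OF this inj_g[OF that]] disj[OF that]]
    show ?thesis unfolding P_def N_def .
  qed
  have N_g: "N S (g s) = range (\<lambda>m. g ` level_cone (T S) s m)" if "S \<subseteq> Range lt" "s \<in> T S" for S s
  proof -
    have "g s \<notin> Y" using disj[OF that(1)] that(2) by blast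
    then show ?thesis using inv_into_f_f[OF inj_g[OF that(1)] that(2)] unfolding N_def by auto
  qed
  have sum: "ranked_sum (P S) (N S)
      (\<lambda>x. if x \<in> Y then (if x = p then 0 else 1) else length (inv_into (T S) g x)) Y p lt K S g"
    if S: "S \<subseteq> Range lt" for S
  proof (intro ranked_sum.intro ranked_sum_axioms.intro)
    show "P S = Y \<union> g ` tree_nodes lt S" by (simp add: P_def T_def)
    show "Y \<inter> g ` tree_nodes lt S = {}" using disj[OF S] by (simp add: T_def)
    show "inj_on g (tree_nodes lt S)" using inj_g[OF S] by (simp add: T_def)
    show "N S (g s) = range (\<lambda>m. g ` level_cone (tree_nodes lt S) s m)" if "s \<in> tree_nodes lt S" for s
      using N_g[OF S, of s] that by (simp add: T_def)
    show "V \<subseteq> Y" if "x \<in> Y" "V \<in> N S x" for x V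
      using that coding_baseD(1)[OF B(1)] pM(1,2) by (fastforce simp: N_def filter_nbhds_def split: if_splits)
    show "{x} \<in> N S x" if "x \<in> Y" "x \<noteq> p" for x using that by (simp add: N_def filter_nbhds_def)
  qed (use tree[OF S] lt S in simp_all)
  have PK: "Y \<subseteq> P S" "P S \<subseteq> K" if "S \<subseteq> Range lt" for S
    using gZ[OF that] YK unfolding P_def by auto
  have weight: "has_weight (?X S) r" if S: "S \<subseteq> Range lt" for S
  proof (rule coding_has_weight[OF tree[OF S] r _ _ _ _ B(1)])
    show "p \<in> P S" "M \<subseteq> P S - {p}" using pM PK[OF S] by auto
    show "N S p = insert p ` B" using pM(1) by (simp add: N_def filter_nbhds_def)
    show "{x} \<in> N S x" if "x \<in> M" for x using that pM(2) by (auto simp: N_def filter_nbhds_def)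
    show "|P S| \<le>o r" using card_of_mono1[OF PK(2)[OF S]] KKr(1) by (rule ordLeq_transitive)
    have nat_r: "|UNIV :: nat set| \<le>o r"
      using r(2) infinite_iff_card_of_nat ordLeq_ordIso_trans[OF _ Fr] by blast
    show "|N S x| \<le>o r" if x: "x \<in> P S" for x
    proof (cases "x \<in> Y")
      case True
      show ?thesis
      proof (cases "x = p")
        case True
        have "|insert p ` B| \<le>o r" by (rule ordLeq_transitive[OF card_of_image Br])
        then show ?thesis using True pM(1) by (simp add: N_def filter_nbhds_def)
      next
        case False
        have "|{{x}}| \<le>o |Field r|" using r(2) by (intro finite_ordLeq_infinite) auto
        from ordLeq_ordIso_trans[OF this Fr] show ?thesis
          using False \<open>x \<in> Y\<close> by (simp add: N_def filter_nbhds_def)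
      qed
    next
      case False
      then obtain s where "s \<in> T S" "x = g s" using x unfolding P_def by blast
      then have "N S x = range (\<lambda>m. g ` level_cone (T S) s m)" using N_g[OF S] by simp
      then show ?thesis using ordLeq_transitive[OF card_of_image nat_r] by simp
    qed
  qed
  have differ: "S = S'" if S: "S \<subseteq> Range lt" "S' \<subseteq> Range lt" and hom: "?X S homeomorphic_space ?X S'" for S S'
  proof -
    have dec: "i \<in> U \<longleftrightarrow> rank_limit (?X U) lt i" if "U \<subseteq> Range lt" "i \<in> Range lt" for U i
      using ranked_sum.rank_limitI[OF sum[OF that(1)]] ranked_sum.rank_limitD[OF sum[OF that(1)]] that(2) by blast
    have "rank_limit (?X S) lt i \<longleftrightarrow> rank_limit (?X S') lt i" for i
      using rank_limit_homeomorphic hom homeomorphic_space_sym by metis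
    then show ?thesis using dec S by blast
  qed
  let ?F = "?X ` Pow (Range lt)"
  have inj: "inj_on ?X (Pow (Range lt))"
  proof (rule inj_onI)
    fix S S' assume SS: "S \<in> Pow (Range lt)" "S' \<in> Pow (Range lt)" "?X S = ?X S'"
    then have "?X S homeomorphic_space ?X S'" by simp
    then show "S = S'" using differ SS(1,2) by blast
  qed
  have "|Pow (Range lt)| =o |?F|" using inj_on_imp_bij_betw[OF inj] by (rule card_of_ordIsoI)
  moreover have "|Pow K| =o |Pow (Range lt)|"
    using card_of_Range_order[OF k] card_of_Pow_mono unfolding K_def lt_def ordIso_iff_ordLeq by blast
  ultimately have card: "|?F| =o |Pow K|" using ordIso_symmetric ordIso_transitive by blast
  have pw: "pairwise (\<lambda>X Y. \<not> X homeomorphic_space Y) ?F"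
    unfolding pairwise_def using differ by blast
  have props: "|topspace (?X S)| =o |K| \<and> has_weight (?X S) r \<and> scattered_space (?X S) \<and>
      strongly_zero_dimensional_space (?X S) \<and> hereditarily_paracompact_space (?X S) \<and>
      perfectly_normal_space (?X S)" if S: "S \<subseteq> Range lt" for S
  proof -
    note tr = tree[OF S]
    \<comment> \<open>\<open>P S\<close> lies between the equinumerous sets \<open>Y\<close> and
      \<open>K\<close>, but need not be all of \<open>K\<close>.\<close>
    have "|P S| =o |K|"
      using card_of_mono1[OF PK(2)[OF S]] ordIso_ordLeq_trans[OF KY(1) card_of_mono1[OF PK(1)[OF S]]]
      by (simp add: ordIso_iff_ordLeq)
    then show ?thesis
      using weight[OF S] nbhd_tree.topspace_X[OF tr] nbhd_tree.scattered_X[OF tr]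
        nbhd_tree.strongly_zero_dimensional_X[OF tr] nbhd_tree.hereditarily_paracompact_X[OF tr]
        nbhd_tree.perfectly_normal_X[OF tr] by simp
  qed
  show ?thesis
    using card pw props unfolding K_def[symmetric] by (intro exI[of _ ?F]) blast
qed

theorem theorem1:
  fixes \<kappa> :: "'a rel" and \<Lambda> :: "'b rel"
  assumes "Card_order \<kappa>" and "cinfinite \<kappa>"
    and "Card_order \<Lambda>" and "cinfinite \<Lambda>"
    and "\<kappa> \<le>o \<Lambda>" and "\<Lambda> \<le>o ctwo ^c \<kappa>"
  shows "(\<exists>\<F> :: 'a topology set.
            |\<F>| =o ctwo ^c \<Lambda> \<and>
            pairwise (\<lambda>X Y. \<not> X homeomorphic_space Y) \<F> \<and>
            (\<forall>X\<in>\<F>. |topspace X| =o \<kappa> \<and> has_weight X \<Lambda> \<and>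
               scattered_space X \<and> strongly_zero_dimensional_space X \<and>
               hereditarily_paracompact_space X \<and> perfectly_normal_space X))
       \<and> ((\<exists>\<mu> :: 'c rel. Card_order \<mu> \<and> cinfinite \<mu> \<and>
              \<Lambda> \<le>o ctwo ^c \<mu> \<and> ctwo ^c \<mu> <o ctwo ^c \<Lambda>) \<longrightarrow>
          (\<exists>\<F> :: 'a topology set.
            |\<F>| =o ctwo ^c \<Lambda> \<and>
            pairwise (\<lambda>X Y. \<not> X homeomorphic_space Y) \<F> \<and>
            (\<forall>X\<in>\<F>. |topspace X| =o \<kappa> \<and> has_weight X \<Lambda> \<and>
               scattered_space X \<and> strongly_zero_dimensional_space X \<and>
               hereditarily_paracompact_space X \<and> perfectly_normal_space X \<and>
               almost_discrete_space X)))
       \<and> ((\<exists>\<mu> :: 'c rel. Card_order \<mu> \<and> cinfinite \<mu> \<and> \<Lambda> =o ctwo ^c \<mu>) \<longrightarrow>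
          (\<exists>\<F> :: 'a topology set.
            |\<F>| =o ctwo ^c \<Lambda> \<and>
            pairwise (\<lambda>X Y. \<not> X homeomorphic_space Y) \<F> \<and>
            (\<forall>X\<in>\<F>. |topspace X| =o \<kappa> \<and> has_weight X \<Lambda> \<and>
               scattered_space X \<and> strongly_zero_dimensional_space X \<and>
               hereditarily_paracompact_space X \<and> perfectly_normal_space X \<and>
               almost_discrete_space X \<and> extremally_disconnected_space X)))"
proof -
  let ?K = "Field \<kappa>"
  have K: "infinite ?K" and L: "infinite (Field \<Lambda>)" using assms(2,4) by (auto simp: cinfinite_def)
  have K\<kappa>: "|?K| =o \<kappa>" by (rule card_of_Field_ordIso[OF assms(1)])
  have KL: "|?K| \<le>o \<Lambda>" using K\<kappa> assms(5) by (rule ordIso_ordLeq_trans)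
  have LK: "\<Lambda> \<le>o |Pow ?K|" using assms(6) ctwo_cexp_Pow by (rule ordLeq_ordIso_trans)
  have PL: "ctwo ^c \<Lambda> =o |Pow (Field \<Lambda>)|" by (rule ctwo_cexp_Pow)
  have one: "\<exists>\<F> :: 'a topology set. |\<F>| =o ctwo ^c \<Lambda> \<and> pairwise (\<lambda>X Y. \<not> X homeomorphic_space Y) \<F> \<and>
      (\<forall>X\<in>\<F>. |topspace X| =o \<kappa> \<and> has_weight X \<Lambda> \<and> scattered_space X \<and>
        strongly_zero_dimensional_space X \<and> hereditarily_paracompact_space X \<and> perfectly_normal_space X)"
  proof (cases "|Pow ?K| <o |Pow (Field \<Lambda>)|")
    case True
    show ?thesis
      using almost_discrete_family_exists[OF assms(3) L K KL LK K LK True] K\<kappa> by metis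
  next
    case False
    have "|?K| \<le>o |Field \<Lambda>|" using assms(5) by (rule card_of_mono2)
    then have "|Pow ?K| \<le>o |Pow (Field \<Lambda>)|" by (rule card_of_Pow_mono)
    \<comment> \<open>By monotonicity only equality is left, so \<open>2^\<kappa>\<close> spaces are
      enough.\<close>
    then have "|Pow ?K| =o |Pow (Field \<Lambda>)|" using False ordLeq_iff_ordLess_or_ordIso by blast
    then have c: "|Pow ?K| =o ctwo ^c \<Lambda>" using ordIso_symmetric[OF PL] by (rule ordIso_transitive)
    show ?thesis
      using scattered_family_exists[OF assms(1) K assms(3) L KL LK] ordIso_transitive[OF _ c]
        ordIso_transitive[OF _ K\<kappa>] by meson
  qed
  have two: "\<exists>\<F> :: 'a topology set. |\<F>| =o ctwo ^c \<Lambda> \<and> pairwise (\<lambda>X Y. \<not> X homeomorphic_space Y) \<F> \<and>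
      (\<forall>X\<in>\<F>. |topspace X| =o \<kappa> \<and> has_weight X \<Lambda> \<and> scattered_space X \<and>
        strongly_zero_dimensional_space X \<and> hereditarily_paracompact_space X \<and> perfectly_normal_space X \<and>
        almost_discrete_space X)"
    if \<mu>: "cinfinite \<mu>" "\<Lambda> \<le>o ctwo ^c \<mu>" "ctwo ^c \<mu> <o ctwo ^c \<Lambda>" for \<mu> :: "'c rel"
  proof -
    have "infinite (Field \<mu>)" using \<mu>(1) by (simp add: cinfinite_def)
    moreover have "\<Lambda> \<le>o |Pow (Field \<mu>)|" using \<mu>(2) ctwo_cexp_Pow by (rule ordLeq_ordIso_trans)
    moreover have "|Pow (Field \<mu>)| <o |Pow (Field \<Lambda>)|"
      using ordIso_ordLess_trans[OF ordIso_symmetric[OF ctwo_cexp_Pow] \<mu>(3)] PL by (rule ordLess_ordIso_trans)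
    ultimately show ?thesis
      using almost_discrete_family_exists[OF assms(3) L K KL LK] K\<kappa> by metis
  qed
  have three: "\<exists>\<F> :: 'a topology set. |\<F>| =o ctwo ^c \<Lambda> \<and> pairwise (\<lambda>X Y. \<not> X homeomorphic_space Y) \<F> \<and>
      (\<forall>X\<in>\<F>. |topspace X| =o \<kappa> \<and> has_weight X \<Lambda> \<and> scattered_space X \<and>
        strongly_zero_dimensional_space X \<and> hereditarily_paracompact_space X \<and> perfectly_normal_space X \<and>
        almost_discrete_space X \<and> extremally_disconnected_space X)"
    if \<mu>: "cinfinite \<mu>" "\<Lambda> =o ctwo ^c \<mu>" for \<mu> :: "'c rel"
  proof -
    have "infinite (Field \<mu>)" using \<mu>(1) by (simp add: cinfinite_def)
    moreover have "\<Lambda> =o |Pow (Field \<mu>)|" using \<mu>(2) ctwo_cexp_Pow by (rule ordIso_transitive)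
    ultimately show ?thesis
      using extremally_disconnected_family_exists[OF assms(3) L K KL LK] K\<kappa> by metis
  qed
  show ?thesis
    by (intro conjI impI; (elim exE conjE)?) (rule one, erule (2) two, erule (1) three)
qed

end
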